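(* Let $v(2,2)$ be the value of the double limit game $DLG(2,2)$ and $v_X(2,2)$ the value of its extremal version $XDLG(2,2)$ (values measured as the expected score of the searcher, who maximizes). Then $v(2,2) < v_X(2,2)$.
   Context: Pure searching strategy with parameter $\lambda=\infty$: a function $f:[0,1]\times[0,\infty)\to[0,1]$, $(t,x)\mapsto f_t(x)$, measurable in $x$, nondecreasing in $t$, with $\int_0^\infty f_1(x)\,dx\le 1$, together with update rules as follows. Suppose nuts are placed at points $(x_i,y_i)$ ($x_i$ the location, $y_i$ the depth). Let $t^*$ be the smallest $t$ such that $f_t(x_i)\ge y_i$ for some $i$. If there is no such $i$ even at $t=1$, the game ends. Otherwise the nut at $(x_i,y_i)$ is found, the searcher learns its position and the time $t^*$, the nut is removed, and the searcher may change the values $f_t$ for $t\in(t^*,1]$ (the resulting function on all of $[0,1]$ must again be nondecreasing in $t$ with $\int f_1\le 1$); then the evaluation continues, and so on. The searcher knows nothing about the nuts except what he has found. Double limit game $DLG(2,2)$: the hider chooses $y_1,y_2\in[0,1]$ with $y_1+y_2\le 1$; in the extremal version $XDLG(2,2)$ he must choose $y_1+y_2=1$. Simultaneously, the searcher chooses a pure searching strategy with parameter $\lambda=\infty$ (a function $f:[0,1]\times[0,\infty)\to[0,1]$, measurable in $x$, nondecreasing in $t$, with $\int_0^\infty f_1(x)\,dx\le1$, together with rules for changing $f_t$ on $t\in(t^*,1]$ after a nut is found at time $t^*$). The score of the searcher is the 2-dimensional Lebesgue measure of the set of pairs $(x_1,x_2)\in(0,\infty)^2$ such that, with nuts placed at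 $(x_1,y_1)$ and $(x_2,y_2)$, his strategy finds both nuts. The searcher wants to maximize and the hider wants to minimize the expected score; both may use mixed strategies. This is a zero-sum game, and its value is the common value of $\sup_{\text{searcher}}\inf_{\text{hider}}$ and $\inf_{\text{hider}}\sup_{\text{searcher}}$ of the expected score (only mixed strategies for which expected scores are defined are considered). *)

theory Defs
  imports "HOL-Analysis.Analysis" "HOL-Probability.Probability"
begin

text \<open>A digging function \<open>f\<close> is applied as \<open>f t x\<close>, for \<open>f\<^sub>t(x)\<close>; only its values for \<open>t \<in> [0,1]\<close> and
  \<open>x \<in> [0,\<infinity>)\<close> matter. A nut is a pair (location, depth).\<close>

type_synonym digging = "real \<Rightarrow> real \<Rightarrow> real"
type_synonym nut = "real \<times> real"

definition digging_function :: "digging \<Rightarrow> bool" where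
  "digging_function f \<longleftrightarrow>
     (\<forall>t\<in>{0..1}. f t \<in> borel_measurable (lebesgue_on {0..})) \<and>
     (\<forall>t\<in>{0..1}. \<forall>x\<ge>0. f t x \<in> {0..1}) \<and>
     (\<forall>x\<ge>0. mono_on {0..1} (\<lambda>t. f t x)) \<and>
     (\<integral>\<^sup>+x. ennreal (f 1 x) \<partial>lebesgue_on {0..}) \<le> 1"

text \<open>A pure strategy is an initial digging function \<open>f\<close> with an update rule \<open>u\<close>: after a nut \<open>p\<close> is
  found at time \<open>t\<close>, digging continues according to \<open>u p t\<close>. With two nuts, updating
  once is enough. The rule sees the position of the nut found, but not which of the two it is.\<close>

type_synonym strategy = "digging \<times> (nut \<Rightarrow> real \<Rightarrow> digging)"

definition pure_strategies :: "strategy set" where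
  "pure_strategies =
     {(f, u). digging_function f \<and>
        (\<forall>x\<ge>0. \<forall>y\<in>{0..1}. \<forall>t\<in>{0..1}.
           digging_function (u (x, y) t) \<and>
           (\<forall>s\<in>{0..t}. \<forall>x'\<ge>0. u (x, y) t s x' = f s x'))}"

definition reached :: "digging \<Rightarrow> real \<Rightarrow> nut \<Rightarrow> bool" where
  "reached f t p \<longleftrightarrow> snd p \<le> f t (fst p)"

text \<open>\<open>next_found f P t p\<close>: \<open>t\<close> is the smallest time at which \<open>f\<close> reaches some nut of \<open>P\<close>, and \<open>p\<close> is
  a nut reached at that time. Digging functions need not be right-continuous in \<open>t\<close>; if no smallest
  time exists, no nut is found.\<close>

definition next_found :: "digging \<Rightarrow> nut set \<Rightarrow> real \<Rightarrow> nut \<Rightarrow> bool" where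
  "next_found f P t p \<longleftrightarrow>
     t \<in> {0..1} \<and> p \<in> P \<and> reached f t p \<and> (\<forall>s\<in>{0..<t}. \<forall>q\<in>P. \<not> reached f s q)"

definition finds_in_order :: "strategy \<Rightarrow> nut \<Rightarrow> nut \<Rightarrow> bool" where
  "finds_in_order \<sigma> p q \<longleftrightarrow>
     (\<exists>t t'. next_found (fst \<sigma>) {p, q} t p \<and> next_found (snd \<sigma> p t) {q} t' q)"

text \<open>If both nuts are reached at the same time \<open>t\<close>, it does not matter which counts as the first:
  the update leaves the values at \<open>t\<close> unchanged, so the other one is found as well.\<close>

definition finds_both :: "strategy \<Rightarrow> nut \<Rightarrow> nut \<Rightarrow> bool" where
  "finds_both \<sigma> p q \<longleftrightarrow> finds_in_order \<sigma> p q \<or> finds_in_order \<sigma> q p"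

definition found_pairs :: "strategy \<Rightarrow> real \<times> real \<Rightarrow> (real \<times> real) set" where
  "found_pairs \<sigma> = (\<lambda>(y1, y2).
     {(x1, x2). 0 < x1 \<and> 0 < x2 \<and> finds_both \<sigma> (x1, y1) (x2, y2)})"

definition score :: "strategy \<Rightarrow> real \<times> real \<Rightarrow> ennreal" where
  "score \<sigma> y = emeasure lebesgue (found_pairs \<sigma> y)"

text \<open>The two games differ only in the set \<open>H\<close> of pure strategies of the hider.\<close>

definition DLG :: "(real \<times> real) set" where
  "DLG = {(y1, y2). y1 \<in> {0..1} \<and> y2 \<in> {0..1} \<and> y1 + y2 \<le> 1}"

definition XDLG :: "(real \<times> real) set" where
  "XDLG = {(y1, y2). y1 \<in> {0..1} \<and> y2 \<in> {0..1} \<and> y1 + y2 = 1}"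

definition hider_mixed :: "(real \<times> real) set \<Rightarrow> (real \<times> real) measure set" where
  "hider_mixed H = {N. prob_space N \<and> sets N = sets (restrict_space borel H)}"

definition expected_score_defined :: "strategy measure \<Rightarrow> (real \<times> real) measure \<Rightarrow> bool" where
  "expected_score_defined M N \<longleftrightarrow>
     (AE (\<sigma>, y) in M \<Otimes>\<^sub>M N. found_pairs \<sigma> y \<in> sets lebesgue) \<and>
     (\<lambda>(\<sigma>, y). score \<sigma> y) \<in> borel_measurable (completion (M \<Otimes>\<^sub>M N))"

definition expected_score :: "strategy measure \<Rightarrow> (real \<times> real) measure \<Rightarrow> ennreal" where
  "expected_score M N = (\<integral>\<^sup>+(\<sigma>, y). score \<sigma> y \<partial>completion (M \<Otimes>\<^sub>M N))"

text \<open>There is no canonical \<open>\<sigma>\<close>-algebra on the pure strategies, so a mixed strategy of the searcher may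
  carry any \<open>\<sigma>\<close>-algebra for which its expected score is defined against every mixed strategy of the
  hider.\<close>

definition searcher_mixed :: "(real \<times> real) set \<Rightarrow> strategy measure set" where
  "searcher_mixed H =
     {M. prob_space M \<and> space M \<subseteq> pure_strategies \<and>
         (\<forall>N\<in>hider_mixed H. expected_score_defined M N)}"

definition is_game_value :: "(real \<times> real) set \<Rightarrow> ennreal \<Rightarrow> bool" where
  "is_game_value H v \<longleftrightarrow>
     v = (SUP M\<in>searcher_mixed H. INF N\<in>hider_mixed H. expected_score M N) \<and>
     v = (INF N\<in>hider_mixed H. SUP M\<in>searcher_mixed H. expected_score M N)"

end

theory Submission
  imports Defs
begin

text \<open>
  The two values are separated by 2: \<open>v \<le> 100/49 < 49/24 \<le> v\<^sub>X\<close>.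

  In the double limit game let the hider choose \<open>(y\<^sub>1, y\<^sub>2)\<close> almost uniformly on the triangle
  \<open>y\<^sub>1 + y\<^sub>2 \<le> 1\<close>. The locations are measured by Lebesgue measure, so the two nuts become two points
  \<open>p\<close>, \<open>q\<close> of the region to be dug. If \<open>p\<close> is found when an area \<open>\<alpha>\<close> has been dug, then \<open>q\<close> lies in the
  area at most \<open>1 - \<alpha>\<close> that is dug later. So the pairs in which \<open>p\<close> comes first have measure at most
  \<open>\<integral> (1 - \<alpha>) d\<alpha> = 1/2\<close>, all pairs have measure at most 1, and since the density of the hider's
  distribution is 2, no strategy scores more than 2. A finite grid of depths loses a factor
  \<open>k / (k - 1)\<close>.

  In the extremal game the searcher, having found a nut at depth \<open>y\<close>, knows that the other depth is
  \<open>1 - y\<close>. Digging columns of depth \<open>d\<close> one after the other and switching to depth \<open>1 - y\<close> after the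
  first find scores \<open>1 / (2 d y (1 - y))\<close> when \<open>y\<close> and \<open>1 - y\<close> are at most \<open>d\<close>. With \<open>d = 1\<close> this
  exceeds 2 except at \<open>y = 1/2\<close>, with \<open>d = 3/4\<close> it exceeds 2 around \<open>y = 1/2\<close>. Spending half of the
  budget on columns of either depth gives more than 2 for all \<open>y\<close>.
\<close>

subsection \<open>The hider in the double limit game\<close>

text \<open>A countable cover for \<open>lborel\<close> serves its completion too. Tonelli for the
  product of two completed measures rests on this.\<close>

lemma sigma_finite_lebesgue:
  "sigma_finite_measure (lebesgue :: 'a::euclidean_space measure)"
proof -
  obtain A :: "'a set set" where A: "countable A" "A \<subseteq> sets lborel" "\<Union>A = space lborel"
    "\<forall>a\<in>A. emeasure lborel a \<noteq> \<infinity>"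
    using lborel.sigma_finite_countable by blast
  show ?thesis
  proof
    show "\<exists>A::'a set set. countable A \<and> A \<subseteq> sets lebesgue \<and> \<Union>A = space lebesgue \<and>
        (\<forall>a\<in>A. emeasure lebesgue a \<noteq> \<infinity>)"
      using A by (intro exI[of _ A]) (auto simp: subset_iff)
  qed
qed

section \<open>Level sets of a digging function and their total measure\<close>

lemma digging_functionD:
  assumes "digging_function f"
  shows "\<And>t. t \<in> {0..1} \<Longrightarrow> f t \<in> borel_measurable (lebesgue_on {0..})"
    and "\<And>t x. t \<in> {0..1} \<Longrightarrow> 0 \<le> x \<Longrightarrow> 0 \<le> f t x \<and> f t x \<le> 1"
    and "\<And>s t x. 0 \<le> x \<Longrightarrow> 0 \<le> s \<Longrightarrow> s \<le> t \<Longrightarrow> t \<le> 1 \<Longrightarrow> f s x \<le> f t x"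
    and "(\<integral>\<^sup>+x. ennreal (f 1 x) \<partial>lebesgue_on {0..}) \<le> 1"
  using assms unfolding digging_function_def mono_on_def by force+

text \<open>The area dug in the strip between the depths \<open>(a - 1)/k\<close> and \<open>a/k\<close> is at least the measure of
  \<open>level k (f t) a\<close> divided by \<open>k\<close>.\<close>

definition level :: "nat \<Rightarrow> (real \<Rightarrow> real) \<Rightarrow> nat \<Rightarrow> real set" where
  "level k g a = {x. 0 < x \<and> real a / real k \<le> g x}"

lemma level_sets:
  assumes "digging_function f" "t \<in> {0..1}"
  shows "level k (f t) a \<in> sets lebesgue"
proof -
  have "f t \<in> borel_measurable (lebesgue_on {0..})"
    using assms digging_functionD by blast
  then have "{x \<in> space (lebesgue_on {0..}). real a / real k \<le> f t x} \<in> sets (lebesgue_on {0..})"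
    by measurable
  then have "{x \<in> {0..}. real a / real k \<le> f t x} \<in> sets lebesgue"
    by (subst (asm) sets_restrict_space_iff) (auto simp: space_restrict_space)
  moreover have "level k (f t) a = {x \<in> {0..}. real a / real k \<le> f t x} \<inter> {0<..}"
    by (auto simp: level_def)
  ultimately show ?thesis by (simp add: sets.Int)
qed

lemma level_mono:
  assumes "digging_function f" "0 \<le> s" "s \<le> t" "t \<le> 1"
  shows "level k (f s) a \<subseteq> level k (f t) a"
  using digging_functionD(3)[OF assms(1) _ assms(2-4)] unfolding level_def
  by (auto intro: order_trans)

text \<open>At each location at most \<open>k * f t x\<close> of the depths \<open>a / k\<close> are
  reached; integrating this count over \<open>x\<close> brings in the budget of
  \<open>f 1\<close>.\<close>

lemma level_budget:
  assumes f: "digging_function f" and t: "t \<in> {0..1}" and k: "k > 0"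
  shows "(\<Sum>a=1..k. emeasure lebesgue (level k (f t) a)) \<le> of_nat k"
proof -
  let ?M = "lebesgue_on {0..} :: real measure"
  have sets: "level k (f t) a \<in> sets ?M" for a
    using level_sets[OF f t] by (subst sets_restrict_space_iff) (auto simp: level_def)
  have pointwise: "(\<Sum>a=1..k. indicator (level k (f t) a) x) \<le> of_nat k * ennreal (f 1 x)"
    if "x \<in> space ?M" for x
  proof -
    have x: "x \<ge> 0" using that by (simp add: space_restrict_space)
    have r: "0 \<le> f t x" "f t x \<le> f 1 x"
      using digging_functionD[OF f] t x by auto
    define n where "n = nat \<lfloor>real k * f t x\<rfloor>"
    have "{a \<in> {1..k}. x \<in> level k (f t) a} \<subseteq> {1..n}"
    proof
      fix a assume "a \<in> {a \<in> {1..k}. x \<in> level k (f t) a}"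
      then have "1 \<le> a" "real a \<le> real k * f t x"
        using k by (auto simp: level_def field_simps)
      then show "a \<in> {1..n}" unfolding n_def by (simp add: le_nat_floor)
    qed
    then have "card {a \<in> {1..k}. x \<in> level k (f t) a} \<le> n"
      using card_mono[of "{1..n}"] by fastforce
    moreover have "real n \<le> real k * f t x" unfolding n_def using r by simp
    moreover have "real k * f t x \<le> real k * f 1 x" using r by (simp add: mult_left_mono)
    ultimately have "real (card {a \<in> {1..k}. x \<in> level k (f t) a}) \<le> real k * f 1 x"
      by linarith
    moreover have "(\<Sum>a=1..k. indicator (level k (f t) a) x)
        = (of_nat (card {a \<in> {1..k}. x \<in> level k (f t) a}) :: ennreal)"
      by (simp add: indicator_def sum.If_cases Int_def)
    ultimately have "(\<Sum>a=1..k. indicator (level k (f t) a) x) \<le> ennreal (real k * f 1 x)"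
      by (metis ennreal_leI ennreal_of_nat_eq_real_of_nat)
    then show ?thesis
      using r by (simp add: ennreal_mult ennreal_of_nat_eq_real_of_nat)
  qed
  have "(\<Sum>a=1..k. emeasure lebesgue (level k (f t) a)) = (\<Sum>a=1..k. emeasure ?M (level k (f t) a))"
    by (intro sum.cong refl emeasure_restrict_space[symmetric]) (auto simp: level_def)
  also have "\<dots> = (\<Sum>a=1..k. \<integral>\<^sup>+x. indicator (level k (f t) a) x \<partial>?M)"
    using sets by simp
  also have "\<dots> = (\<integral>\<^sup>+x. (\<Sum>a=1..k. indicator (level k (f t) a) x) \<partial>?M)"
    using sets by (subst nn_integral_sum) auto
  also have "\<dots> \<le> (\<integral>\<^sup>+x. of_nat k * ennreal (f 1 x) \<partial>?M)"
    by (intro nn_integral_mono pointwise)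
  also have "\<dots> = of_nat k * (\<integral>\<^sup>+x. ennreal (f 1 x) \<partial>?M)"
    using digging_functionD(1)[OF f, of 1] by (intro nn_integral_cmult) auto
  also have "\<dots> \<le> of_nat k * 1"
    by (intro mult_left_mono digging_functionD(4)[OF f]) auto
  finally show ?thesis by simp
qed

lemma level_finite:
  assumes f: "digging_function f" and t: "t \<in> {0..1}" and a: "a \<in> {1..k}"
  shows "emeasure lebesgue (level k (f t) a) \<le> of_nat k"
    and "emeasure lebesgue (level k (f t) a) < \<infinity>"
proof -
  have "emeasure lebesgue (level k (f t) a) \<le> (\<Sum>a=1..k. emeasure lebesgue (level k (f t) a))"
    using a by (intro member_le_sum) auto
  also have "\<dots> \<le> of_nat k" using level_budget[OF f t, of k] a by auto
  finally show "emeasure lebesgue (level k (f t) a) \<le> of_nat k" .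
  then show "emeasure lebesgue (level k (f t) a) < \<infinity>"
    by (rule order.strict_trans1) (simp add: of_nat_less_top)
qed

section \<open>Order of discovery, tested at countably many times\<close>

definition level_mass :: "nat \<Rightarrow> digging \<Rightarrow> real \<Rightarrow> real" where
  "level_mass k f t = (\<Sum>b=1..k. measure lebesgue (level k (f t) b))"

text \<open>Whether \<open>f\<close> reaches one nut strictly before another one is an uncountable union over the times of
  digging, and need not be measurable in the locations. Countably many times suffice up to null
  sets: the rational ones, and those where a set of positive measure is dug at once.\<close>

definition test_times :: "nat \<Rightarrow> digging \<Rightarrow> real set" where
  "test_times k f =
     {t \<in> {0..1}. t \<in> \<rat> \<or> \<not> continuous (at t within {0..1}) (level_mass k f)}"

lemma level_fmeasurable:
  assumes "digging_function f" "t \<in> {0..1}" "a \<in> {1..k}"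
  shows "level k (f t) a \<in> fmeasurable lebesgue"
  using level_finite(2)[OF assms] level_sets[OF assms(1,2)] by (intro fmeasurableI) auto

lemma mono_level_mass:
  assumes "digging_function f"
  shows "mono_on {0..1} (level_mass k f)"
  unfolding level_mass_def using assms
  by (intro mono_onI sum_mono measure_mono_fmeasurable level_mono level_sets level_fmeasurable) auto

text \<open>One monotone function accounts for all \<open>k\<close> levels at once, and it has only
  countably many discontinuities.\<close>

lemma countable_test_times:
  assumes "digging_function f"
  shows "countable (test_times k f)"
proof -
  have "test_times k f \<subseteq>
      \<rat> \<union> {t \<in> {0..1}. \<not> continuous (at t within {0..1}) (level_mass k f)}"
    by (auto simp: test_times_def)
  then show ?thesis
    by (rule countable_subset)
      (intro countable_Un countable_rat mono_on_ctble_discont mono_level_mass assms)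
qed

lemma test_times_subset: "test_times k f \<subseteq> {0..1}"
  by (auto simp: test_times_def)

lemma one_in_test_times: "1 \<in> test_times k f"
  by (auto simp: test_times_def)

text \<open>The relation "reached strictly earlier", in a form that is a countable union of
  measurable rectangles.\<close>

definition before :: "nat \<Rightarrow> digging \<Rightarrow> nat \<Rightarrow> nat \<Rightarrow> (real \<times> real) set" where
  "before k f a b = (\<Union>t\<in>test_times k f. level k (f t) a \<times> ({0<..} - level k (f t) b))"

lemma before_sets:
  assumes "digging_function f"
  shows "before k f a b \<in> sets (lebesgue \<Otimes>\<^sub>M lebesgue)"
  unfolding before_def
proof (intro sets.countable_UN'' countable_test_times assms)
  fix t assume "t \<in> test_times k f"
  then have "t \<in> {0..1}" using test_times_subset by blast
  then show "level k (f t) a \<times> ({0<..} - level k (f t) b) \<in> sets (lebesgue \<Otimes>\<^sub>M lebesgue)"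
    using level_sets[OF assms] by (intro pair_measureI sets.Diff) auto
qed

text \<open>Levels grow with time, so membership at the earlier of the two witnessing times
  contradicts non-membership at the later one.\<close>

lemma before_asym:
  assumes f: "digging_function f" and "(x, x') \<in> before k f a b" "(x', x) \<in> before k f b a"
  shows False
proof -
  obtain s t where s: "s \<in> {0..1}" "x \<in> level k (f s) a" "x' \<notin> level k (f s) b"
    and t: "t \<in> {0..1}" "x' \<in> level k (f t) b" "x \<notin> level k (f t) a"
    using assms(2,3) test_times_subset unfolding before_def by fastforce
  show False
    using s t level_mono[OF f, of s t k a] level_mono[OF f, of t s k b] by (cases "s \<le> t") auto
qed

text \<open>Outside the test times \<open>level_mass\<close> is continuous, so rational times
  shortly after \<open>t\<close> add arbitrarily little to any level.\<close>

lemma null_set_between_test_times: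
  assumes f: "digging_function f" and t: "t \<in> {0..1}" "t \<notin> test_times k f" and b: "b \<in> {1..k}"
  shows "(\<Inter>r\<in>{r \<in> test_times k f. t < r}. level k (f r) b) - level k (f t) b \<in> null_sets lebesgue"
    (is "?Z \<in> _")
proof -
  have t1: "t < 1" using t one_in_test_times[of k f] by (cases "t = 1") auto
  have ne: "{r \<in> test_times k f. t < r} \<noteq> {}" using one_in_test_times t1 by blast
  have Z: "?Z \<in> sets lebesgue"
  proof (intro sets.Diff sets.countable_INT'' level_sets[OF f] t(1) ne)
    show "countable {r \<in> test_times k f. t < r}"
      by (rule countable_subset[OF _ countable_test_times[OF f, of k]]) auto
  qed (auto simp: test_times_def)
  have cont: "continuous (at t within {0..1}) (level_mass k f)"
    using t by (auto simp: test_times_def)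
  have small: "emeasure lebesgue ?Z \<le> ennreal e" if e: "e > 0" for e
  proof -
    obtain d where d: "d > 0"
      "\<And>s. s \<in> {0..1} \<Longrightarrow> dist s t < d \<Longrightarrow> dist (level_mass k f s) (level_mass k f t) < e"
      using cont e unfolding continuous_within_eps_delta by blast
    obtain r where r: "r \<in> \<rat>" "t < r" "r < min 1 (t + d)"
      using Rats_dense_in_real[of t "min 1 (t + d)"] t1 d(1) by auto
    have r01: "r \<in> {0..1}" and rT: "r \<in> test_times k f"
      using r t by (auto simp: test_times_def)
    have sub: "level k (f t) c \<subseteq> level k (f r) c" for c
      using t r by (intro level_mono[OF f]) auto
    have "measure lebesgue (level k (f r) b - level k (f t) b)
        = measure lebesgue (level k (f r) b) - measure lebesgue (level k (f t) b)"
      by (rule measurable_measure_Diff[OF level_fmeasurable[OF f r01 b] level_sets[OF f t(1)] sub])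
    \<comment> \<open>Every level gains a nonnegative amount, so one gain is at most the sum of
      all.\<close>
    also have "\<dots> \<le> (\<Sum>c=1..k. measure lebesgue (level k (f r) c) - measure lebesgue (level k (f t) c))"
      using b by (intro member_le_sum) (simp_all add: measure_mono_fmeasurable[OF sub level_sets[OF f t(1)]
            level_fmeasurable[OF f r01]])
    also have "\<dots> = level_mass k f r - level_mass k f t"
      by (simp add: level_mass_def sum_subtractf)
    also have "\<dots> < e"
      using d(2)[OF r01] r by (auto simp: dist_real_def)
    finally have *: "measure lebesgue (level k (f r) b - level k (f t) b) \<le> e" by simp
    have "emeasure lebesgue ?Z \<le> emeasure lebesgue (level k (f r) b - level k (f t) b)"
      using rT r level_sets[OF f] r01 t(1) by (intro emeasure_mono) auto
    also have "\<dots> = ennreal (measure lebesgue (level k (f r) b - level k (f t) b))"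
      by (rule emeasure_eq_measure2[OF fmeasurable_Diff[OF level_fmeasurable[OF f r01 b]
            level_sets[OF f t(1)]]])
    also have "\<dots> \<le> ennreal e" using * by (rule ennreal_leI)
    finally show ?thesis .
  qed
  have "emeasure lebesgue ?Z \<le> 0"
    by (rule ennreal_le_epsilon) (use small in auto)
  then show ?thesis using Z by (auto simp: null_sets_def)
qed

section \<open>What can be found together with a given nut\<close>

lemma pure_strategiesD:
  assumes "(f, u) \<in> pure_strategies"
  shows "digging_function f"
    and "\<And>x y t. 0 \<le> x \<Longrightarrow> y \<in> {0..1} \<Longrightarrow> t \<in> {0..1} \<Longrightarrow> digging_function (u (x, y) t)"
    and "\<And>x y t s x'. 0 \<le> x \<Longrightarrow> y \<in> {0..1} \<Longrightarrow> t \<in> {0..1} \<Longrightarrow> s \<in> {0..t} \<Longrightarrow> 0 \<le> x' \<Longrightarrow>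
      u (x, y) t s x' = f s x'"
  using assms unfolding pure_strategies_def by blast+

lemma finds_both_commute: "finds_both \<sigma> p q \<longleftrightarrow> finds_both \<sigma> q p"
  unfolding finds_both_def by blast

lemma found_pairs_swap:
  "(x1, x2) \<in> found_pairs \<sigma> (y1, y2) \<longleftrightarrow> (x2, x1) \<in> found_pairs \<sigma> (y2, y1)"
  unfolding found_pairs_def using finds_both_commute by auto

text \<open>If the nut at \<open>x\<close> is reached at a first time \<open>t\<close>, then \<open>g\<close> is the update at \<open>t\<close>: it digs out all nuts
  reached by \<open>f\<close> up to \<open>t\<close> and all nuts found after \<open>x\<close>. If there is no first time, the nut at \<open>x\<close> is
  never found first, and \<open>g = f\<close>.\<close>

lemma section_cover:
  assumes \<sigma>: "(f, u) \<in> pure_strategies" and a: "a \<in> {1..k}" and x: "x \<in> level k (f 1) a"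
  obtains g where "digging_function g"
    and "\<And>b. b \<in> {1..k} \<Longrightarrow> \<exists>Z\<in>null_sets lebesgue.
      {x'. 0 < x' \<and> ((x, x') \<notin> before k f a b \<or>
         (x, x') \<in> found_pairs (f, u) (real a / real k, real b / real k))}
      \<subseteq> level k (g 1) b \<union> Z"
proof -
  note f = pure_strategiesD(1)[OF \<sigma>]
  let ?p = "(x, real a / real k)"
  have x0: "x > 0" using x by (auto simp: level_def)
  have y: "real a / real k \<in> {0..1}" using a by auto
  have reach: "reached f s ?p \<longleftrightarrow> x \<in> level k (f s) a" for s
    using x0 by (simp add: reached_def level_def)
  have reach': "reached g s (x', real b / real k) \<longleftrightarrow> x' \<in> level k (g s) b" if "0 < x'" for g s x' b
    using that by (simp add: reached_def level_def)
  show ?thesis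
  proof (cases "\<exists>t\<in>{0..1}. reached f t ?p \<and> (\<forall>s\<in>{0..<t}. \<not> reached f s ?p)")
    case True
    then obtain t where t: "t \<in> {0..1}" "reached f t ?p" "\<And>s. s \<in> {0..<t} \<Longrightarrow> \<not> reached f s ?p"
      by blast
    define g where "g = u ?p t"
    have g: "digging_function g" 
      unfolding g_def by (rule pure_strategiesD(2)[OF \<sigma> _ y t(1)]) (use x0 in simp)
    have gt: "g t x' = f t x'" if "0 < x'" for x'
      unfolding g_def by (rule pure_strategiesD(3)[OF \<sigma> _ y t(1)]) (use x0 t(1) that in auto)
    have ft: "level k (f t) b \<subseteq> level k (g 1) b" for b
    proof -
      have "level k (f t) b = level k (g t) b" using gt by (auto simp: level_def)
      also have "\<dots> \<subseteq> level k (g 1) b" using t by (intro level_mono[OF g]) auto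
      finally show ?thesis .
    qed
    show ?thesis
    proof (rule that[OF g])
      fix b assume b: "b \<in> {1..k}"
      \<comment> \<open>If \<open>t\<close> is a test time, a pair outside \<open>before\<close> has
        \<open>x'\<close> reached by \<open>t\<close>. Otherwise \<open>x'\<close> is only known to
        be reached at every later test time, which leaves a null set of exceptions.\<close>
      define Z where "Z = (if t \<in> test_times k f then {} else
        (\<Inter>r\<in>{r \<in> test_times k f. t < r}. level k (f r) b) - level k (f t) b)"
      have Z: "Z \<in> null_sets lebesgue"
        unfolding Z_def using null_set_between_test_times[OF f t(1) _ b] by auto
      have "x' \<in> level k (g 1) b \<union> Z" if x': "0 < x'" "(x, x') \<notin> before k f a b" for x'
      proof -
        have *: "x' \<in> level k (f r) b" if "r \<in> test_times k f" "t \<le> r" for r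
        proof -
          have "r \<le> 1" using that test_times_subset by fastforce
          then have "x \<in> level k (f r) a"
            using t that level_mono[OF f, of t r k a] by (auto simp: reach)
          then show ?thesis using x' that unfolding before_def by auto
        qed
        then show ?thesis
          using ft[of b] unfolding Z_def by auto
      qed
      moreover have "x' \<in> level k (g 1) b"
        if x': "0 < x'" "(x, x') \<in> before k f a b"
          and F: "(x, x') \<in> found_pairs (f, u) (real a / real k, real b / real k)" for x'
      proof -
        let ?q = "(x', real b / real k)"
        obtain r where r: "r \<in> {0..1}" "reached f r ?p" "\<not> reached f r ?q"
          using x' test_times_subset unfolding before_def reach reach'[OF x'(1)] by fastforce
        have "t \<le> r" using r t(3)[of r] by force
        \<comment> \<open>At time \<open>r\<close> the nut \<open>?p\<close> is reached and
          \<open>?q\<close> is not. If \<open>?q\<close> were found first at \<open>t'\<close>, then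
          \<open>t' \<le> r\<close>, and \<open>?q\<close> would be reached at \<open>r\<close> as
          well.\<close>
        have "\<not> finds_in_order (f, u) ?q ?p"
        proof
          assume "finds_in_order (f, u) ?q ?p"
          then obtain t' where t': "t' \<in> {0..1}" "reached f t' ?q" "\<And>s. s \<in> {0..<t'} \<Longrightarrow> \<not> reached f s ?p"
            unfolding finds_in_order_def next_found_def by auto
          have "t' \<le> r" using r t'(3)[of r] by force
          then have "reached f r ?q"
            using t' r x' level_mono[OF f, of t' r k b] by (auto simp: reach')
          then show False using r by simp
        qed
        then have "finds_in_order (f, u) ?p ?q"
          using F by (auto simp: found_pairs_def finds_both_def)
        then obtain s s' where s: "s \<in> {0..1}" "reached f s ?p" "\<And>r. r \<in> {0..<s} \<Longrightarrow> \<not> reached f r ?p"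
          and s': "s' \<in> {0..1}" "reached (u ?p s) s' ?q"
          unfolding finds_in_order_def next_found_def by auto
        have "s = t" using s(1,2) s(3)[of t] t(1,2) t(3)[of s] by (cases s t rule: linorder_cases) auto
        then have "x' \<in> level k (g s') b" using s' x' by (simp add: g_def reach')
        then show ?thesis using level_mono[OF g, of s' 1 k b] s' by auto
      qed
      ultimately show "\<exists>Z\<in>null_sets lebesgue.
        {x'. 0 < x' \<and> ((x, x') \<notin> before k f a b \<or>
           (x, x') \<in> found_pairs (f, u) (real a / real k, real b / real k))}
        \<subseteq> level k (g 1) b \<union> Z"
        using Z by (intro bexI[of _ Z]) auto
    qed
  next
    case False
    show ?thesis
    proof (rule that[OF f])
      fix b assume b: "b \<in> {1..k}"
      \<comment> \<open>The test time \<open>1\<close> suffices here, since \<open>x\<close> lies in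
        \<open>level k (f 1) a\<close>.\<close>
      have "x' \<in> level k (f 1) b" if x': "0 < x'" "(x, x') \<notin> before k f a b" for x'
        using x x' one_in_test_times[of k f] unfolding before_def by auto
      moreover have "x' \<in> level k (f 1) b"
        if x': "0 < x'" "(x, x') \<in> before k f a b"
          and F: "(x, x') \<in> found_pairs (f, u) (real a / real k, real b / real k)" for x'
      proof -
        let ?q = "(x', real b / real k)"
        have "finds_in_order (f, u) ?p ?q \<or> finds_in_order (f, u) ?q ?p"
          using F by (auto simp: found_pairs_def finds_both_def)
        moreover have "\<not> finds_in_order (f, u) ?p ?q"
          using False unfolding finds_in_order_def next_found_def by auto
        ultimately have "finds_in_order (f, u) ?q ?p" by blast
        then obtain t where t: "t \<in> {0..1}" "reached f t ?q"
          unfolding finds_in_order_def next_found_def by auto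
        then show ?thesis
          using level_mono[OF f, of t 1 k b] x' by (auto simp: reach')
      qed
      ultimately show "\<exists>Z\<in>null_sets lebesgue.
        {x'. 0 < x' \<and> ((x, x') \<notin> before k f a b \<or>
           (x, x') \<in> found_pairs (f, u) (real a / real k, real b / real k))}
        \<subseteq> level k (f 1) b \<union> Z"
        by (intro bexI[of _ "{}"]) auto
    qed
  qed
qed

section \<open>Planar measure and the product of completed line measures\<close>

interpretation lebesgue: sigma_finite_measure "lebesgue :: real measure"
  by (rule sigma_finite_lebesgue)

interpretation lebesgue_pair: pair_sigma_finite "lebesgue :: real measure" "lebesgue :: real measure"
  ..

lemma borel_imp_lebesgue_pair:
  fixes A :: "(real \<times> real) set"
  assumes "A \<in> sets borel"
  shows "A \<in> sets (lebesgue \<Otimes>\<^sub>M lebesgue)"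
proof -
  have "(\<lambda>x. x) \<in> (lebesgue \<Otimes>\<^sub>M lebesgue) \<rightarrow>\<^sub>M (borel \<Otimes>\<^sub>M borel :: (real \<times> real) measure)"
    by (rule measurable_pair)
      (auto simp: comp_def intro: measurable_compose[OF measurable_fst id_borel_measurable_lebesgue[unfolded id_def]]
        measurable_compose[OF measurable_snd id_borel_measurable_lebesgue[unfolded id_def]])
  then have "(\<lambda>x. x) \<in> (lebesgue \<Otimes>\<^sub>M lebesgue) \<rightarrow>\<^sub>M (borel :: (real \<times> real) measure)"
    by (simp add: borel_prod)
  from measurable_sets[OF this assms] show ?thesis
    by (simp add: space_pair_measure)
qed

text \<open>\<open>score\<close> uses the completed planar measure, while \<open>before\<close>
  lives in the product of two completed line measures. On Borel sets both are given by the same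
  slice integrals.\<close>

lemma emeasure_lebesgue_pair_borel:
  fixes A :: "(real \<times> real) set"
  assumes "A \<in> sets borel"
  shows "emeasure (lebesgue \<Otimes>\<^sub>M lebesgue) A = emeasure lborel A"
proof -
  have A: "A \<in> sets (lborel \<Otimes>\<^sub>M lborel)"
    unfolding lborel_prod using assms by simp
  have "emeasure lborel A = emeasure (lborel \<Otimes>\<^sub>M lborel) A"
    by (simp add: lborel_prod)
  also have "\<dots> = (\<integral>\<^sup>+x. emeasure lborel (Pair x -` A) \<partial>lborel)"
    by (rule lborel.emeasure_pair_measure_alt[OF A])
  also have "\<dots> = (\<integral>\<^sup>+x. emeasure lebesgue (Pair x -` A) \<partial>lborel)"
    using sets_Pair1[OF A] by (intro nn_integral_cong) simp
  also have "\<dots> = (\<integral>\<^sup>+x. emeasure lebesgue (Pair x -` A) \<partial>lebesgue)"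
    by (simp add: nn_integral_completion)
  also have "\<dots> = emeasure (lebesgue \<Otimes>\<^sub>M lebesgue) A"
    by (rule lebesgue.emeasure_pair_measure_alt[symmetric, OF borel_imp_lebesgue_pair[OF assms]])
  finally show ?thesis by simp
qed

lemma emeasure_swap_lebesgue_pair:
  fixes A :: "(real \<times> real) set"
  assumes "A \<in> sets (lebesgue \<Otimes>\<^sub>M lebesgue)"
  shows "prod.swap -` A \<in> sets (lebesgue \<Otimes>\<^sub>M lebesgue)"
    and "emeasure (lebesgue \<Otimes>\<^sub>M lebesgue) (prod.swap -` A) = emeasure (lebesgue \<Otimes>\<^sub>M lebesgue) A"
proof -
  have "(\<lambda>(x, y). (y, x)) \<in> (lebesgue \<Otimes>\<^sub>M lebesgue) \<rightarrow>\<^sub>M (lebesgue \<Otimes>\<^sub>M lebesgue :: (real \<times> real) measure)"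
    by (rule measurable_pair_swap')
  moreover have "(\<lambda>(x, y). (y, x)) = (prod.swap :: real \<times> real \<Rightarrow> _)" by auto
  ultimately have "prod.swap \<in> (lebesgue \<Otimes>\<^sub>M lebesgue) \<rightarrow>\<^sub>M (lebesgue \<Otimes>\<^sub>M lebesgue :: (real \<times> real) measure)"
    by simp
  from measurable_sets[OF this assms] show *: "prod.swap -` A \<in> sets (lebesgue \<Otimes>\<^sub>M lebesgue)"
    by (simp add: space_pair_measure)
  show "emeasure (lebesgue \<Otimes>\<^sub>M lebesgue) (prod.swap -` A) = emeasure (lebesgue \<Otimes>\<^sub>M lebesgue) A"
    unfolding lebesgue_pair.emeasure_pair_measure_alt2[OF *] lebesgue.emeasure_pair_measure_alt[OF assms]
    by (intro nn_integral_cong arg_cong[where f = "emeasure lebesgue"]) auto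
qed

section \<open>The total score over a grid of depths\<close>

lemma main_part_subset:
  assumes "S \<in> sets (completion M)"
  shows "main_part M S \<subseteq> S"
  using main_part_null_part_Un[OF assms] by blast

lemma found_pairs_pos: "(x, x') \<in> found_pairs \<sigma> y \<Longrightarrow> 0 < x \<and> 0 < x'"
  by (cases y) (auto simp: found_pairs_def)

text \<open>The nut found first is found by \<open>f\<close> itself, before any update.\<close>

lemma found_pairs_level:
  assumes f: "digging_function f"
    and F: "(x, x') \<in> found_pairs (f, u) (real a / real k, real b / real k)"
  shows "x \<in> level k (f 1) a \<or> x' \<in> level k (f 1) b"
proof -
  have pos: "0 < x" "0 < x'" using found_pairs_pos[OF F] by auto
  have "\<exists>t\<in>{0..1}. reached f t (x, real a / real k) \<or> reached f t (x', real b / real k)"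
    using F by (auto simp: found_pairs_def finds_both_def finds_in_order_def next_found_def)
  then obtain t where "t \<in> {0..1}" "x \<in> level k (f t) a \<or> x' \<in> level k (f t) b"
    using pos by (auto simp: reached_def level_def)
  then show ?thesis
    using level_mono[OF f, of t 1] by auto
qed

definition grid :: "nat \<Rightarrow> (nat \<times> nat) set" where
  "grid k = {(a, b). 1 \<le> a \<and> 1 \<le> b \<and> a + b \<le> k}"

text \<open>For \<open>x\<close> in \<open>L a\<close>, the slices of the sets \<open>C a b\<close>
  at \<open>x\<close> have total measure at most \<open>k\<close> over all \<open>b\<close>: by
  \<open>section_cover\<close> a single digging function covers them up to null sets. Integrating
  over \<open>x\<close> bounds the double count of pairs from above.\<close>

lemma sum_score_grid_le:
  assumes \<sigma>: "\<sigma> \<in> pure_strategies" and k: "0 < k"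
    and meas: "\<And>a b. (a, b) \<in> grid k \<Longrightarrow> found_pairs \<sigma> (real a / real k, real b / real k) \<in> sets lebesgue"
  shows "(\<Sum>(a, b)\<in>grid k. score \<sigma> (real a / real k, real b / real k)) \<le> of_nat (k\<^sup>2)"
proof -
  obtain f u where fu: "\<sigma> = (f, u)" by (cases \<sigma>)
  note \<sigma> = \<sigma>[unfolded fu]
  note f = pure_strategiesD(1)[OF \<sigma>]
  let ?P = "lebesgue \<Otimes>\<^sub>M lebesgue :: (real \<times> real) measure"
  define L where "L = level k (f 1)"
  define F where "F a b = found_pairs (f, u) (real a / real k, real b / real k)" for a b
  define S where "S a b = (if (a, b) \<in> grid k
    then main_part lborel (F a b) \<union> prod.swap -` main_part lborel (F b a) else {})" for a b
  \<comment> \<open>\<open>C a b\<close> consists of the pairs where \<open>x'\<close> is reached no later than \<open>x\<close>, or \<open>x\<close> is found first and \<open>x'\<close> later.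
    A pair of nuts reached by \<open>f\<close> counts for at least one of the two orders, and if it is also found,
    for both. This gives \<open>s + d\<^sup>2 \<le> 2 k d\<close> below, whence \<open>s \<le> k\<^sup>2\<close>.\<close>
  define C where "C a b = L a \<times> {0<..} \<inter> (- before k f a b \<union> S a b)" for a b
  have grid_sym: "(a, b) \<in> grid k \<longleftrightarrow> (b, a) \<in> grid k" for a b by (auto simp: grid_def)
  have F_sets: "F a b \<in> sets lebesgue" if "(a, b) \<in> grid k" for a b
    using meas[OF that] by (simp add: F_def fu)
  have F_swap: "(x, x') \<in> F a b \<longleftrightarrow> (x', x) \<in> F b a" for x x' a b
    unfolding F_def by (rule found_pairs_swap)
  have S_sub: "S a b \<subseteq> F a b" for a b
    using main_part_subset[OF F_sets, of a b] main_part_subset[OF F_sets, of b a] grid_sym[of a b]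
    by (auto simp: S_def F_swap[of _ _ a b])
  have S_swap: "(x, x') \<in> S a b \<longleftrightarrow> (x', x) \<in> S b a" for x x' a b
    using grid_sym[of a b] by (auto simp: S_def)
  have swap_borel: "prod.swap -` A \<in> sets borel" if "A \<in> sets borel" for A :: "(real \<times> real) set"
  proof -
    have "prod.swap \<in> borel_measurable (borel :: (real \<times> real) measure)"
      by (intro borel_measurable_continuous_onI continuous_on_swap)
    from measurable_sets[OF this that] show ?thesis by simp
  qed
  have S_borel: "S a b \<in> sets borel" for a b
  proof -
    have "main_part lborel (F a b) \<in> sets borel" if "(a, b) \<in> grid k" for a b
      using main_part_sets[OF F_sets[OF that]] by simp
    then show ?thesis
      using grid_sym[of a b] by (simp add: S_def sets.Un swap_borel)
  qed
  have S_P: "S a b \<in> sets ?P" for a b by (rule borel_imp_lebesgue_pair[OF S_borel])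
  have score_S: "score \<sigma> (real a / real k, real b / real k) \<le> emeasure ?P (S a b)" if "(a, b) \<in> grid k" for a b
  proof -
    have "score \<sigma> (real a / real k, real b / real k) = emeasure lborel (main_part lborel (F a b))"
      using F_sets[OF that] by (simp add: score_def F_def fu emeasure_completion)
    also have "\<dots> \<le> emeasure lborel (S a b)"
    proof (rule emeasure_mono)
      show "main_part lborel (F a b) \<subseteq> S a b" using that by (simp add: S_def)
    qed (simp add: S_borel)
    finally show ?thesis by (simp add: emeasure_lebesgue_pair_borel[OF S_borel])
  qed
  have L_sets: "L a \<in> sets lebesgue" for a
    unfolding L_def using level_sets[OF f] by simp
  have L_pos: "x \<in> L a \<Longrightarrow> 0 < x" for x a by (simp add: L_def level_def)
  have C_P: "C a b \<in> sets ?P" for a b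
  proof -
    have "- before k f a b = space ?P - before k f a b" by (auto simp: space_pair_measure)
    then have "- before k f a b \<in> sets ?P"
      using sets.compl_sets[OF before_sets[OF f]] by metis
    then show ?thesis
      unfolding C_def using S_P L_sets by (intro sets.Int sets.Un pair_measureI) auto
  qed
  have pointwise: "indicator (S a b) z + indicator (L a \<times> L b) z
      \<le> (indicator (C a b) z + indicator (prod.swap -` C b a) z :: ennreal)" for a b z
  proof (cases z)
    case (Pair x x')
    have S: "0 < x \<and> 0 < x' \<and> (x \<in> L a \<or> x' \<in> L b)" if "(x, x') \<in> S a b"
      using that S_sub[of a b] found_pairs_pos[of x x'] found_pairs_level[OF f, of x x' u a k b]
      unfolding F_def L_def by blast
    have C1: "(x, x') \<in> C a b \<longleftrightarrow> x \<in> L a \<and> 0 < x' \<and> ((x, x') \<notin> before k f a b \<or> (x, x') \<in> S a b)"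
      by (auto simp: C_def)
    have C2: "(x', x) \<in> C b a \<longleftrightarrow> x' \<in> L b \<and> 0 < x \<and> ((x', x) \<notin> before k f b a \<or> (x, x') \<in> S a b)"
      by (auto simp: C_def S_swap)
    note asym = before_asym[OF f, of x x' k a b]
    have 1: "(x, x') \<in> C a b \<or> (x', x) \<in> C b a" if "(x, x') \<in> S a b \<or> (x \<in> L a \<and> x' \<in> L b)"
    proof (cases "x \<in> L a \<and> x' \<in> L b")
      \<comment> \<open>By asymmetry of \<open>before\<close>, at least one of the two orders lies
        outside it.\<close>
      case True
      then show ?thesis using asym L_pos unfolding C1 C2 by auto
    next
      case False
      then show ?thesis using that S unfolding C1 C2 by auto
    qed
    have 2: "(x, x') \<in> C a b \<and> (x', x) \<in> C b a" if "(x, x') \<in> S a b" "x \<in> L a \<and> x' \<in> L b"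
      using that L_pos unfolding C1 C2 by auto
    show ?thesis
      unfolding Pair indicator_def vimage_def mem_Collect_eq mem_Times_iff fst_conv snd_conv swap_simp
      using 1 2 by (cases "(x, x') \<in> S a b"; cases "x \<in> L a \<and> x' \<in> L b") auto
  qed
  have pair_le: "emeasure ?P (S a b) + emeasure lebesgue (L a) * emeasure lebesgue (L b)
      \<le> emeasure ?P (C a b) + emeasure ?P (C b a)" for a b
  proof -
    have LL: "L a \<times> L b \<in> sets ?P" using L_sets by simp
    have "emeasure ?P (S a b) + emeasure lebesgue (L a) * emeasure lebesgue (L b)
        = emeasure ?P (S a b) + emeasure ?P (L a \<times> L b)"
      using L_sets by (simp add: lebesgue.emeasure_pair_measure_Times)
    also have "\<dots> = (\<integral>\<^sup>+z. indicator (S a b) z + indicator (L a \<times> L b) z \<partial>?P)"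
      using S_P LL by (simp add: nn_integral_add)
    also have "\<dots> \<le> (\<integral>\<^sup>+z. indicator (C a b) z + indicator (prod.swap -` C b a) z \<partial>?P)"
      by (intro nn_integral_mono pointwise)
    also have "\<dots> = emeasure ?P (C a b) + emeasure ?P (C b a)"
      using C_P emeasure_swap_lebesgue_pair[OF C_P] by (simp add: nn_integral_add)
    finally show ?thesis .
  qed
  have slice_le: "(\<Sum>b=1..k. emeasure lebesgue (Pair x -` C a b)) \<le> of_nat k * indicator (L a) x"
    if a: "a \<in> {1..k}" for a x
  proof (cases "x \<in> L a")
    case True
    obtain g where g: "digging_function g"
      and cover: "\<And>b. b \<in> {1..k} \<Longrightarrow> \<exists>Z\<in>null_sets lebesgue.
      {x'. 0 < x' \<and> ((x, x') \<notin> before k f a b \<or>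
         (x, x') \<in> found_pairs (f, u) (real a / real k, real b / real k))}
      \<subseteq> level k (g 1) b \<union> Z"
      using section_cover[OF \<sigma> a True[unfolded L_def]] by blast
    have "emeasure lebesgue (Pair x -` C a b) \<le> emeasure lebesgue (level k (g 1) b)" if b: "b \<in> {1..k}" for b
    proof -
      obtain Z where Z: "Z \<in> null_sets lebesgue" "Pair x -` C a b \<subseteq> level k (g 1) b \<union> Z"
        using cover[OF b] S_sub[of a b] unfolding C_def F_def by blast
      have g1: "level k (g 1) b \<in> sets lebesgue" using level_sets[OF g] by simp
      have "emeasure lebesgue (Pair x -` C a b) \<le> emeasure lebesgue (level k (g 1) b \<union> Z)"
        using Z g1 by (intro emeasure_mono) auto
      also have "\<dots> = emeasure lebesgue (level k (g 1) b)"
        by (rule emeasure_Un_null_set[OF g1 Z(1)])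
      finally show ?thesis .
    qed
    then have "(\<Sum>b=1..k. emeasure lebesgue (Pair x -` C a b)) \<le> (\<Sum>b=1..k. emeasure lebesgue (level k (g 1) b))"
      by (intro sum_mono) auto
    also have "\<dots> \<le> of_nat k" using level_budget[OF g _ k] by simp
    finally show ?thesis using True by simp
  next
    case False
    then have "Pair x -` C a b = {}" for b by (auto simp: C_def)
    then show ?thesis by simp
  qed
  have C_le: "(\<Sum>b=1..k. emeasure ?P (C a b)) \<le> of_nat k * emeasure lebesgue (L a)" if a: "a \<in> {1..k}" for a
  proof -
    have "(\<Sum>b=1..k. emeasure ?P (C a b)) = (\<Sum>b=1..k. \<integral>\<^sup>+x. emeasure lebesgue (Pair x -` C a b) \<partial>lebesgue)"
      by (simp add: lebesgue.emeasure_pair_measure_alt[OF C_P])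
    also have "\<dots> = (\<integral>\<^sup>+x. (\<Sum>b=1..k. emeasure lebesgue (Pair x -` C a b)) \<partial>lebesgue)"
      by (rule nn_integral_sum[symmetric]) (rule lebesgue.measurable_emeasure_Pair[OF C_P])
    also have "\<dots> \<le> (\<integral>\<^sup>+x. of_nat k * indicator (L a) x \<partial>lebesgue)"
      by (intro nn_integral_mono slice_le a)
    also have "\<dots> = of_nat k * emeasure lebesgue (L a)"
      using L_sets by (rule nn_integral_cmult_indicator)
    finally show ?thesis .
  qed
  define d where "d = (\<Sum>a=1..k. emeasure lebesgue (L a))"
  define s where "s = (\<Sum>a=1..k. \<Sum>b=1..k. emeasure ?P (S a b))"
  have "s + d * d = (\<Sum>a=1..k. \<Sum>b=1..k. emeasure ?P (S a b) + emeasure lebesgue (L a) * emeasure lebesgue (L b))"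
    by (simp add: s_def d_def sum.distrib sum_product)
  also have "\<dots> \<le> (\<Sum>a=1..k. \<Sum>b=1..k. emeasure ?P (C a b) + emeasure ?P (C b a))"
    by (intro sum_mono pair_le)
  also have "\<dots> = (\<Sum>a=1..k. \<Sum>b=1..k. emeasure ?P (C a b)) + (\<Sum>a=1..k. \<Sum>b=1..k. emeasure ?P (C a b))"
    unfolding sum.distrib by (intro arg_cong2[where f = "(+)"] refl sum.swap)
  also have "\<dots> \<le> (\<Sum>a=1..k. of_nat k * emeasure lebesgue (L a)) + (\<Sum>a=1..k. of_nat k * emeasure lebesgue (L a))"
    by (intro add_mono sum_mono C_le)
  also have "\<dots> = of_nat k * d + of_nat k * d"
    by (simp add: d_def sum_distrib_left)
  finally have main: "s + d * d \<le> of_nat k * d + of_nat k * d" .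
  have d_le: "d \<le> of_nat k"
    unfolding d_def L_def using level_budget[OF f _ k] by simp
  \<comment> \<open>Completing the square needs subtraction, so \<open>d\<close> and
    \<open>s\<close> are first shown to be finite and replaced by real numbers.\<close>
  have "s \<le> of_nat (k\<^sup>2)"
  proof -
    obtain r where r: "d = ennreal r" "0 \<le> r"
      using d_le by (cases d) (auto simp: top_unique)
    have kd: "of_nat k * d = ennreal (real k * r)"
      unfolding r(1) ennreal_of_nat_eq_real_of_nat using r(2) by (intro ennreal_mult[symmetric]) auto
    have rhs: "of_nat k * d + of_nat k * d = ennreal (real k * r + real k * r)"
      unfolding kd using r(2) by (intro ennreal_plus[symmetric]) auto
    have "s \<le> s + d * d" by simp
    also note main
    finally have "s \<noteq> \<top>" unfolding rhs by (auto simp: top_unique)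
    then obtain q where q: "s = ennreal q" "0 \<le> q"
      by (cases s) auto
    have "s + d * d = ennreal (q + r * r)"
      unfolding q(1) r(1) using q(2) r(2)
      by (subst ennreal_mult[symmetric]) (auto intro!: ennreal_plus[symmetric])
    then have "q + r * r \<le> real k * r + real k * r"
      using main r(2) unfolding rhs by (simp add: ennreal_le_iff)
    moreover have "0 \<le> (real k - r)\<^sup>2" by simp
    moreover have "(real k)\<^sup>2 - (real k * r + real k * r - r * r) = (real k - r)\<^sup>2"
      by (simp add: power2_eq_square algebra_simps)
    ultimately have "q \<le> (real k)\<^sup>2"
      by linarith
    then show ?thesis
      using q by (metis ennreal_leI ennreal_of_nat_eq_real_of_nat of_nat_power)
  qed
  moreover have "(\<Sum>(a, b)\<in>grid k. score \<sigma> (real a / real k, real b / real k)) \<le> s"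
  proof -
    have "(\<Sum>(a, b)\<in>grid k. score \<sigma> (real a / real k, real b / real k)) \<le> (\<Sum>(a, b)\<in>grid k. emeasure ?P (S a b))"
      using score_S by (intro sum_mono) auto
    also have "\<dots> \<le> (\<Sum>(a, b)\<in>{1..k} \<times> {1..k}. emeasure ?P (S a b))"
      by (intro sum_mono2) (auto simp: grid_def)
    also have "\<dots> = s" by (simp add: s_def sum.cartesian_product)
    finally show ?thesis .
  qed
  ultimately show ?thesis by (rule order_trans[rotated])
qed

section \<open>The uniform distribution on the grid as a mixed strategy\<close>

lemma finite_grid: "finite (grid k)"
  by (rule finite_subset[of _ "{1..k} \<times> {1..k}"]) (auto simp: grid_def)

text \<open>Passing from \<open>k\<close> to \<open>Suc k\<close> adds the \<open>k\<close> points
  with \<open>a + b = Suc k\<close>.\<close>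

lemma card_grid: "2 * card (grid k) = k * (k - 1)"
proof (induction k)
  case 0
  have "grid 0 = {}" by (auto simp: grid_def)
  then show ?case by simp
next
  case (Suc k)
  have eq: "grid (Suc k) = grid k \<union> (\<lambda>a. (a, Suc k - a)) ` {1..k}"
    by (auto simp: grid_def image_iff)
  have "card (grid (Suc k)) = card (grid k) + card ((\<lambda>a. (a, Suc k - a)) ` {1..k})"
    unfolding eq by (intro card_Un_disjoint finite_grid) (auto simp: grid_def)
  also have "card ((\<lambda>a. (a, Suc k - a)) ` {1..k}) = k"
    by (subst card_image) (auto simp: inj_on_def)
  finally show ?case using Suc by (cases k) (auto simp: algebra_simps)
qed

text \<open>The default \<open>(0, 0)\<close> lies in \<open>DLG\<close>, so the map takes all its
  values there. On a nonempty grid the uniform distribution never uses the default.\<close>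

definition grid_point :: "nat \<Rightarrow> nat \<times> nat \<Rightarrow> real \<times> real" where
  "grid_point k z = (if z \<in> grid k then (real (fst z) / real k, real (snd z) / real k) else (0, 0))"

definition grid_hider :: "nat \<Rightarrow> (real \<times> real) measure" where
  "grid_hider k = distr (measure_pmf (pmf_of_set (grid k))) (restrict_space borel DLG) (grid_point k)"

lemma grid_point_measurable:
  "grid_point k \<in> measure_pmf p \<rightarrow>\<^sub>M restrict_space borel DLG"
proof (rule measurable_restrict_space2)
  have "grid_point k z \<in> DLG" for z
  proof (cases "z \<in> grid k")
    case True
    then obtain a b where "z = (a, b)" "1 \<le> a" "1 \<le> b" "a + b \<le> k"
      by (cases z) (auto simp: grid_def)
    moreover have "real a + real b \<le> real k" using \<open>a + b \<le> k\<close> by linarith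
    ultimately show ?thesis
      using True by (auto simp: grid_point_def DLG_def divide_simps)
  qed (auto simp: grid_point_def DLG_def)
  then show "grid_point k \<in> space (measure_pmf p) \<rightarrow> DLG" by auto
qed simp

lemma grid_hider_in: "grid_hider k \<in> hider_mixed DLG"
  unfolding hider_mixed_def grid_hider_def
  by (auto intro!: measure_pmf.prob_space_distr grid_point_measurable)

text \<open>Against each pure strategy the expected score is the grid sum divided by the size of the
  grid, at most \<open>k^2 / (k * (k - 1) / 2)\<close>.\<close>

lemma expected_score_grid_hider_le:
  assumes M: "M \<in> searcher_mixed DLG" and k: "2 \<le> k"
  shows "expected_score M (grid_hider k) \<le> ennreal (2 * real k / (real k - 1))"
proof -
  let ?N = "grid_hider k" and ?c = "ennreal (2 * real k / (real k - 1))"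
  let ?score = "\<lambda>z. score (fst z) (snd z)"
  interpret M: prob_space M using M by (simp add: searcher_mixed_def)
  interpret N: prob_space ?N using grid_hider_in[of k] by (simp add: hider_mixed_def)
  interpret MN: pair_prob_space M ?N ..
  have "expected_score_defined M ?N"
    using M grid_hider_in[of k] by (auto simp: searcher_mixed_def)
  then have meas: "AE z in M \<Otimes>\<^sub>M ?N. found_pairs (fst z) (snd z) \<in> sets lebesgue"
    and score: "?score \<in> borel_measurable (completion (M \<Otimes>\<^sub>M ?N))"
    by (auto simp: expected_score_defined_def case_prod_beta')
  \<comment> \<open>The score is measurable only for the completion; Tonelli is applied to an almost
    everywhere equal \<open>h\<close> that is measurable on the product itself.\<close>
  obtain h where h: "h \<in> borel_measurable (M \<Otimes>\<^sub>M ?N)" and eq: "AE z in M \<Otimes>\<^sub>M ?N. ?score z = h z"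
    using completion_ex_borel_measurable[OF score] by blast
  have ne: "grid k \<noteq> {}"
    using k by (auto simp: grid_def intro!: exI[of _ 1])
  have card: "real (card (grid k)) = real k * (real k - 1) / 2"
  proof -
    have "2 * real (card (grid k)) = real (k * (k - 1))"
      using card_grid[of k] by (metis of_nat_mult of_nat_numeral)
    then show ?thesis using k by (simp add: of_nat_diff)
  qed
  have "(\<integral>\<^sup>+y. h (\<sigma>, y) \<partial>?N) \<le> ?c"
    if \<sigma>: "\<sigma> \<in> space M" and ae: "AE y in ?N. score \<sigma> y = h (\<sigma>, y) \<and> found_pairs \<sigma> y \<in> sets lebesgue" for \<sigma>
  proof -
    have "AE z in measure_pmf (pmf_of_set (grid k)).
        score \<sigma> (grid_point k z) = h (\<sigma>, grid_point k z) \<and> found_pairs \<sigma> (grid_point k z) \<in> sets lebesgue"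
      using ae unfolding grid_hider_def by (rule AE_distrD[OF grid_point_measurable])
    \<comment> \<open>Each grid point has positive mass, so an almost sure property holds at every
      one of them.\<close>
    then have *: "score \<sigma> (grid_point k z) = h (\<sigma>, grid_point k z)"
      "found_pairs \<sigma> (grid_point k z) \<in> sets lebesgue" if "z \<in> grid k" for z
      using that ne finite_grid by (auto simp: AE_measure_pmf_iff)
    have pure: "\<sigma> \<in> pure_strategies" using M \<sigma> by (auto simp: searcher_mixed_def)
    have h\<sigma>: "(\<lambda>y. h (\<sigma>, y)) \<in> borel_measurable ?N"
      using h \<sigma> by measurable
    have "(\<integral>\<^sup>+y. h (\<sigma>, y) \<partial>?N) = (\<integral>\<^sup>+z. h (\<sigma>, grid_point k z) \<partial>measure_pmf (pmf_of_set (grid k)))"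
      using h\<sigma> unfolding grid_hider_def by (intro nn_integral_distr grid_point_measurable) simp
    also have "\<dots> = (\<Sum>z\<in>grid k. h (\<sigma>, grid_point k z)) / of_nat (card (grid k))"
      by (rule nn_integral_pmf_of_set[OF ne finite_grid])
    also have "(\<Sum>z\<in>grid k. h (\<sigma>, grid_point k z)) =
        (\<Sum>(a, b)\<in>grid k. score \<sigma> (real a / real k, real b / real k))"
      using *(1) by (intro sum.cong) (auto simp: grid_point_def)
    also have "\<dots> \<le> of_nat (k\<^sup>2)"
      using k *(2) by (intro sum_score_grid_le pure) (auto simp: grid_point_def)
    finally have "(\<integral>\<^sup>+y. h (\<sigma>, y) \<partial>?N) \<le> of_nat (k\<^sup>2) / of_nat (card (grid k))"
      by (simp add: divide_right_mono_ennreal)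
    also have "\<dots> = ennreal (real (k\<^sup>2) / real (card (grid k)))"
      using ne finite_grid by (simp add: ennreal_of_nat_eq_real_of_nat divide_ennreal card_gt_0_iff)
    also have "real (k\<^sup>2) / real (card (grid k)) = 2 * real k / (real k - 1)"
      using k unfolding card by (simp add: power2_eq_square field_simps)
    finally show ?thesis .
  qed
  moreover have "AE \<sigma> in M. AE y in ?N. score \<sigma> y = h (\<sigma>, y) \<and> found_pairs \<sigma> y \<in> sets lebesgue"
    using MN.AE_pair[OF AE_conjI[OF eq meas]] by simp
  ultimately have bound: "AE \<sigma> in M. (\<integral>\<^sup>+y. h (\<sigma>, y) \<partial>?N) \<le> ?c"
    by (auto elim: AE_mp)
  have "expected_score M ?N = (\<integral>\<^sup>+z. h z \<partial>(M \<Otimes>\<^sub>M ?N))"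
    unfolding expected_score_def nn_integral_completion case_prod_beta'
    by (rule nn_integral_cong_AE[OF eq])
  also have "\<dots> = (\<integral>\<^sup>+\<sigma>. \<integral>\<^sup>+y. h (\<sigma>, y) \<partial>?N \<partial>M)"
    by (rule N.nn_integral_fst[OF h, symmetric])
  also have "\<dots> \<le> (\<integral>\<^sup>+\<sigma>. ?c \<partial>M)"
    by (rule nn_integral_mono_AE[OF bound])
  also have "\<dots> = ?c" by (simp add: M.emeasure_space_1)
  finally show ?thesis .
qed

lemma game_value_DLG_le:
  assumes "is_game_value DLG v" and "2 \<le> k"
  shows "v \<le> ennreal (2 * real k / (real k - 1))"
proof -
  have "v = (INF N\<in>hider_mixed DLG. SUP M\<in>searcher_mixed DLG. expected_score M N)"
    using assms(1) unfolding is_game_value_def by (rule conjunct2)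
  also have "\<dots> \<le> (SUP M\<in>searcher_mixed DLG. expected_score M (grid_hider k))"
    by (rule INF_lower[OF grid_hider_in])
  also have "\<dots> \<le> ennreal (2 * real k / (real k - 1))"
    using assms(2) by (intro SUP_least expected_score_grid_hider_le)
  finally show ?thesis .
qed

subsection \<open>The searcher in the extremal game\<close>

text \<open>Area \<open>1/2\<close> is spent on width \<open>1/2\<close> at depth \<open>1\<close>,
  the other half on width \<open>2/3\<close> at depth \<open>3/4\<close>, so the columns end at
  \<open>7/6\<close>.\<close>

definition col_depth :: "real \<Rightarrow> real" where
  "col_depth x = (if x \<le> 1/2 then 1 else 3/4)"

text \<open>The locations up to \<open>front t\<close> are dug at time \<open>t\<close>, and \<open>t\<close> is also the area dug by then; \<open>start\<close> is the
  inverse of \<open>front\<close>.\<close>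

definition front :: "real \<Rightarrow> real" where
  "front t = max t ((8 * t - 1) / 6)"

definition start :: "real \<Rightarrow> real" where
  "start x = min x ((6 * x + 1) / 8)"

text \<open>The two lines in \<open>front\<close> are increasing and cross at
  \<open>t = 1/2\<close>; their slopes \<open>1\<close> and \<open>4/3\<close> are the reciprocals
  of the depths. The maximum of the lines turns into the minimum of their inverses.\<close>

lemma le_front_iff: "x \<le> front t \<longleftrightarrow> start x \<le> t"
  by (auto simp: front_def start_def min_def max_def field_simps)

lemma front_less_iff: "front t < x \<longleftrightarrow> t < start x"
  using le_front_iff[of x t] by linarith

lemma front_start: "front (start x) = x"
  by (auto simp: front_def start_def min_def max_def field_simps)

lemma start_less_iff: "start x < start x' \<longleftrightarrow> x < x'"
  by (auto simp: start_def min_def field_simps)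

lemma start_le_iff: "start x \<le> start x' \<longleftrightarrow> x \<le> x'"
  using start_less_iff[of x' x] by linarith

lemma start_pos: "0 < x \<Longrightarrow> 0 < start x"
  by (auto simp: start_def)

definition col_dig :: digging where
  "col_dig t x = (if start x \<le> t then col_depth x else 0)"

text \<open>All of the remaining budget is spent at time \<open>1\<close>; digging immediately after \<open>t\<close> would leave no
  smallest time at which the second nut is reached. For \<open>snd p = 1\<close> the division by zero makes the
  new region empty.\<close>

definition col_update :: "nut \<Rightarrow> real \<Rightarrow> digging" where
  "col_update p t s x =
     (if s \<le> t then col_dig s x
      else if 1 \<le> s \<and> front t < x \<and> x \<le> front t + (1 - t) / (1 - snd p) then 1 - snd p
      else col_dig t x)"

definition column_strategy :: strategy where
  "column_strategy = (col_dig, col_update)"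

section \<open>The column strategy respects the budget\<close>

lemma measurable_start [measurable]: "start \<in> borel_measurable borel"
  unfolding start_def by measurable

lemma measurable_col_depth [measurable]: "col_depth \<in> borel_measurable borel"
  unfolding col_depth_def by measurable

lemma measurable_col_dig [measurable]: "col_dig t \<in> borel_measurable borel"
  unfolding col_dig_def[abs_def] by measurable

lemma measurable_col_update [measurable]: "col_update p t s \<in> borel_measurable borel"
  unfolding col_update_def[abs_def] by measurable

lemma measurable_lebesgue_onI:
  fixes f :: "real \<Rightarrow> real"
  shows "f \<in> borel_measurable borel \<Longrightarrow> f \<in> borel_measurable (lebesgue_on A)"
  by (intro measurable_restrict_space1 measurable_completion) simp

lemma col_dig_bounds: "0 \<le> col_dig t x" "col_dig t x \<le> 1"
  by (auto simp: col_dig_def col_depth_def)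

lemma col_dig_mono: "s \<le> t \<Longrightarrow> col_dig s x \<le> col_dig t x"
  by (auto simp: col_dig_def col_depth_def)

lemma nn_integral_col_dig:
  assumes "0 \<le> t"
  shows "(\<integral>\<^sup>+x. ennreal (col_dig t x) * indicator {0..} x \<partial>lborel) = ennreal t"
proof -
  have "(\<integral>\<^sup>+x. ennreal (col_dig t x) * indicator {0..} x \<partial>lborel) =
      (\<integral>\<^sup>+x. indicator {0..min (1/2) (front t)} x + ennreal (3/4) * indicator {1/2<..front t} x \<partial>lborel)"
    by (intro nn_integral_cong)
      (auto simp: col_dig_def col_depth_def le_front_iff[symmetric] indicator_def)
  also have "\<dots> = emeasure lborel {0..min (1/2) (front t)} + ennreal (3/4) * emeasure lborel {1/2<..front t}"
    by (subst nn_integral_add) (auto simp: nn_integral_cmult)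
  also have "\<dots> = ennreal t"
  proof (cases "t \<le> 1/2")
    case True
    then have "front t = t" by (auto simp: front_def)
    moreover have "{1/2<..t} = {}" using True by auto
    ultimately show ?thesis using True assms by (simp only:) (simp add: min_absorb2)
  next
    case False
    then have front: "front t = (8 * t - 1) / 6" "1/2 \<le> front t" by (auto simp: front_def field_simps)
    have "emeasure lborel {0..min (1/2) (front t)} = ennreal (1/2)"
      using front(2) by (simp add: min_absorb1)
    moreover have "ennreal (3/4) * emeasure lborel {1/2<..front t} = ennreal (3/4 * (front t - 1/2))"
      using front(2) by (subst emeasure_lborel_Ioc, simp, subst ennreal_mult) simp_all
    moreover have "3/4 * (front t - 1/2) = t - 1/2" by (simp add: front(1) field_simps)
    moreover have "ennreal (1/2) + ennreal (t - 1/2) = ennreal t"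
      using False by (subst ennreal_plus[symmetric]) auto
    ultimately show ?thesis by (simp only:)
  qed
  finally show ?thesis .
qed

lemma digging_function_col_dig: "digging_function col_dig"
proof -
  have "(\<integral>\<^sup>+x. ennreal (col_dig 1 x) \<partial>lebesgue_on {0..}) = 1"
    using nn_integral_col_dig[of 1]
    by (subst nn_integral_restrict_space) (auto simp: nn_integral_completion)
  then show ?thesis
    unfolding digging_function_def
    by (auto intro!: mono_onI col_dig_mono col_dig_bounds measurable_lebesgue_onI)
qed

text \<open>The new columns lie beyond \<open>front t\<close>, where nothing is dug by time
  \<open>t\<close>. This gives monotonicity, and their area is at most the remaining
  \<open>1 - t\<close>.\<close>

lemma digging_function_col_update:
  assumes y: "y \<in> {0..1}" and t: "t \<in> {0..1}"
  shows "digging_function (col_update (x, y) t)"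
proof -
  have "(\<integral>\<^sup>+x'. ennreal (col_update (x, y) t 1 x') \<partial>lebesgue_on {0..})
      = (\<integral>\<^sup>+x'. ennreal (col_update (x, y) t 1 x') * indicator {0..} x' \<partial>lborel)"
    by (subst nn_integral_restrict_space) (auto simp: nn_integral_completion)
  also have "\<dots> \<le> (\<integral>\<^sup>+x'. ennreal (col_dig t x') * indicator {0..} x'
      + ennreal (1 - y) * indicator {front t<..front t + (1 - t) / (1 - y)} x' \<partial>lborel)"
    using t y by (intro nn_integral_mono) (auto simp: col_update_def indicator_def col_dig_def)
  also have "\<dots> = ennreal t + ennreal (1 - y) * emeasure lborel {front t<..front t + (1 - t) / (1 - y)}"
    using t by (subst nn_integral_add) (auto simp: nn_integral_cmult nn_integral_col_dig)
  also have "\<dots> \<le> ennreal t + ennreal (1 - t)"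
  \<comment> \<open>At \<open>y = 1\<close> the new depth is \<open>0\<close> and the added term
    vanishes.\<close>
  proof (cases "y = 1")
    case False
    then show ?thesis using y t
      by (intro add_left_mono) (simp add: ennreal_mult[symmetric])
  qed simp
  also have "\<dots> = 1" using t by (simp flip: ennreal_plus)
  finally have budget: "(\<integral>\<^sup>+x'. ennreal (col_update (x, y) t 1 x') \<partial>lebesgue_on {0..}) \<le> 1" .
  have "0 \<le> col_update (x, y) t s x' \<and> col_update (x, y) t s x' \<le> 1" for s x'
    using y col_dig_bounds[of s x'] col_dig_bounds[of t x'] by (auto simp: col_update_def)
  moreover have "col_update (x, y) t s x' \<le> col_update (x, y) t s' x'" if "s \<le> s'" for s s' x'
    using that y col_dig_mono[of s s' x'] col_dig_mono[of s t x'] col_dig_mono[of t s' x']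
    by (auto simp: col_update_def col_dig_def front_less_iff)
  ultimately show ?thesis
    unfolding digging_function_def using budget
    by (auto intro!: mono_onI measurable_lebesgue_onI)
qed

lemma column_strategy_pure: "column_strategy \<in> pure_strategies"
  unfolding column_strategy_def pure_strategies_def
  using digging_function_col_dig digging_function_col_update by (auto simp: col_update_def)

section \<open>The pairs found by the column strategy\<close>

lemma reached_col_dig: "0 < y \<Longrightarrow> reached col_dig t (x, y) \<longleftrightarrow> start x \<le> t \<and> y \<le> col_depth x"
  by (auto simp: reached_def col_dig_def)

text \<open>The argument \<open>x\<close> is the pair of locations, \<open>y\<close> the pair of depths, and the first nut is the one
  found first.\<close>

definition found_after :: "real \<times> real \<Rightarrow> real \<times> real \<Rightarrow> bool" where
  "found_after y x \<longleftrightarrow> start (fst x) \<le> 1 \<and> fst y \<le> col_depth (fst x) \<and>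
     (fst x = snd x \<and> snd y \<le> col_depth (snd x) \<or>
      fst x < snd x \<and> snd x \<le> fst x + (1 - start (fst x)) / snd y)"

text \<open>When the first nut is found, the front is at \<open>x1\<close>. The second nut is either
  in the same column and found at once, or beyond the front and found at time \<open>1\<close> by
  columns of depth exactly \<open>y2\<close>. Behind the front it would have been found earlier or
  is too deep.\<close>

lemma finds_in_order_column_strategy:
  assumes x: "0 < x1" "0 < x2" and y: "0 < y1" "0 < y2" "y1 + y2 = 1"
  shows "finds_in_order column_strategy (x1, y1) (x2, y2) \<longleftrightarrow> found_after (y1, y2) (x1, x2)"
proof
  let ?p = "(x1, y1)" and ?q = "(x2, y2)"
  have st: "0 < start x1" "0 < start x2" using x by (auto intro: start_pos)
  have y2: "1 - y1 = y2" using y by simp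
  have upd: "reached (col_update ?p (start x1)) s ?q \<longleftrightarrow>
      (if s \<le> start x1 then start x2 \<le> s \<and> y2 \<le> col_depth x2
       else if 1 \<le> s \<and> x1 < x2 \<and> x2 \<le> x1 + (1 - start x1) / y2 then True
       else x2 \<le> x1 \<and> y2 \<le> col_depth x2)" for s
    using y by (auto simp: reached_def col_update_def front_start col_dig_def y2 start_le_iff)
  {
    assume "finds_in_order column_strategy ?p ?q"
    then obtain t t' where t: "t \<in> {0..1}" "reached col_dig t ?p"
        "\<And>s. s \<in> {0..<t} \<Longrightarrow> \<not> reached col_dig s ?p \<and> \<not> reached col_dig s ?q"
      and t': "t' \<in> {0..1}" "reached (col_update ?p t) t' ?q"
      by (auto simp: finds_in_order_def next_found_def column_strategy_def)
    have p: "start x1 \<le> t" "y1 \<le> col_depth x1" using t(2) y by (auto simp: reached_col_dig)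
    have "t = start x1"
      using t(3)[of "start x1"] st p y by (cases "start x1 < t") (auto simp: reached_col_dig)
    moreover have "x1 \<le> x2" if "y2 \<le> col_depth x2"
      using t(3)[of "start x2"] st p y that \<open>t = start x1\<close> start_less_iff[of x2 x1]
      by (auto simp: reached_col_dig)
    ultimately show "found_after (y1, y2) (x1, x2)"
      using t' t(1) p upd[of t'] start_le_iff[of x2 x1] by (auto simp: found_after_def split: if_splits)
  next
    assume F: "found_after (y1, y2) (x1, x2)"
    let ?t = "start x1"
    have p: "?t \<le> 1" "y1 \<le> col_depth x1" using F by (auto simp: found_after_def)
    have le: "x1 \<le> x2" using F by (auto simp: found_after_def)
    have first: "next_found col_dig {?p, ?q} ?t ?p"
      using st p le y start_le_iff[of x1 x2] by (auto simp: next_found_def reached_col_dig)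
    have "\<exists>t'. next_found (col_update ?p ?t) {?q} t' ?q"
    proof (cases "x1 = x2")
      case True
      then have "next_found (col_update ?p ?t) {?q} ?t ?q"
        using F st p upd by (auto simp: next_found_def found_after_def)
      then show ?thesis by blast
    next
      case False
      then have F': "x1 < x2" "x2 \<le> x1 + (1 - start x1) / y2" using F by (auto simp: found_after_def)
      \<comment> \<open>With \<open>start x1 = 1\<close> no budget is left and the new interval is
        empty.\<close>
      then have "start x1 < 1" using p by (cases "start x1 = 1") auto
      then show ?thesis
        using F' start_less_iff[of x1 x2]
        by (intro exI[of _ 1]) (auto simp: next_found_def upd)
    qed
    then show "finds_in_order column_strategy ?p ?q"
      using first by (auto simp: finds_in_order_def column_strategy_def)
  }
qed

text \<open>The defining conditions are Borel in depths and locations jointly, which makes the area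
  a measurable function of the depths.\<close>

definition found_region :: "real \<times> real \<Rightarrow> (real \<times> real) set" where
  "found_region y = {x. 0 < fst x \<and> 0 < snd x \<and>
     (found_after y x \<or> found_after (prod.swap y) (prod.swap x))}"

lemma found_pairs_column_strategy:
  assumes "0 < y1" "0 < y2" "y1 + y2 = 1"
  shows "found_pairs column_strategy (y1, y2) = found_region (y1, y2)"
  using assms finds_in_order_column_strategy[of _ _ y1 y2] finds_in_order_column_strategy[of _ _ y2 y1]
  by (auto simp: found_pairs_def found_region_def finds_both_def)

lemma measurable_found_region:
  "{(y, x). x \<in> found_region y} \<in> sets (borel \<Otimes>\<^sub>M lborel)"
proof -
  have [measurable]: "prod.swap \<in> borel_measurable (borel :: (real \<times> real) measure)"
    by (intro borel_measurable_continuous_onI continuous_on_swap)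
  have [measurable]: "fst \<in> borel_measurable (borel :: (real \<times> real) measure)"
    "snd \<in> borel_measurable (borel :: (real \<times> real) measure)"
    by (auto intro!: borel_measurable_continuous_onI continuous_intros)
  have "{z \<in> space (borel \<Otimes>\<^sub>M lborel). snd z \<in> found_region (fst z)} \<in> sets (borel \<Otimes>\<^sub>M lborel)"
    unfolding found_region_def found_after_def mem_Collect_eq by measurable
  also have "{z \<in> space (borel \<Otimes>\<^sub>M lborel). snd z \<in> found_region (fst z)} = {(y, x). x \<in> found_region y}"
    by (auto simp: space_pair_measure)
  finally show ?thesis .
qed

lemma sets_found_region: "found_region y \<in> sets borel"
  using sets_Pair1[OF measurable_found_region, of y] by (simp add: vimage_def)

lemma measurable_emeasure_found_region:
  "(\<lambda>y. emeasure lborel (found_region y)) \<in> borel_measurable borel"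
  using lborel.measurable_emeasure_Pair[OF measurable_found_region] by (simp add: vimage_def)

text \<open>A nut of depth \<open>0\<close> is reached at time \<open>0\<close> wherever it lies, so
  the whole budget is left for width \<open>1\<close> at depth \<open>1\<close>.\<close>

lemma found_pairs_column_strategy_zero:
  "found_pairs column_strategy (0, 1) = {0<..} \<times> {0<..1}"
proof -
  have "finds_both column_strategy (x1, 0) (x2, 1) \<longleftrightarrow> x2 \<le> 1" if x: "0 < x1" "0 < x2" for x1 x2
  proof -
    have front: "front 0 = 0" by (simp add: front_def)
    have st: "0 < start x2" by (rule start_pos[OF x(2)])
    have p: "reached col_dig t (x1, 0)" for t by (simp add: reached_def col_dig_bounds)
    have q: "\<not> reached col_dig 0 (x2, 1)" using st by (simp add: reached_def col_dig_def)
    have "\<not> finds_in_order column_strategy (x2, 1) (x1, 0)"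
    proof
      assume "finds_in_order column_strategy (x2, 1) (x1, 0)"
      then obtain t where "t \<in> {0..1}" "reached col_dig t (x2, 1)" "\<And>s. s \<in> {0..<t} \<Longrightarrow> \<not> reached col_dig s (x1, 0)"
        by (auto simp: finds_in_order_def next_found_def column_strategy_def)
      then show False using p[of 0] q by (cases "t = 0") auto
    qed
    moreover have "next_found col_dig {(x1, 0), (x2, 1)} t (x1, 0) \<longleftrightarrow> t = 0" for t
      using p by (auto simp: next_found_def not_less)
    moreover have upd: "reached (col_update (x1, 0) 0) s (x2, 1) \<longleftrightarrow> 1 \<le> s \<and> x2 \<le> 1" if "0 \<le> s" for s
      using that st x by (auto simp: reached_def col_update_def front col_dig_def)
    moreover have "(\<exists>t. next_found (col_update (x1, 0) 0) {(x2, 1)} t (x2, 1)) \<longleftrightarrow> x2 \<le> 1"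
    proof
      assume "x2 \<le> 1"
      then have "next_found (col_update (x1, 0) 0) {(x2, 1)} 1 (x2, 1)" by (auto simp: next_found_def upd)
      then show "\<exists>t. next_found (col_update (x1, 0) 0) {(x2, 1)} t (x2, 1)" by blast
    qed (auto simp: next_found_def upd)
    ultimately show ?thesis
      by (auto simp: finds_both_def finds_in_order_def column_strategy_def)
  qed
  then show ?thesis by (auto simp: found_pairs_def)
qed

text \<open>The region is an infinite strip; a rectangle of area \<open>3\<close> inside it is
  enough to exceed \<open>49/24\<close>.\<close>

lemma score_column_strategy_zero:
  "found_pairs column_strategy (0, 1) \<in> sets borel" "3 \<le> score column_strategy (0, 1)"
  "found_pairs column_strategy (1, 0) \<in> sets borel" "3 \<le> score column_strategy (1, 0)"
proof -
  have "found_pairs column_strategy (1, 0) = prod.swap ` found_pairs column_strategy (0, 1)"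
    by (auto simp: found_pairs_def image_iff finds_both_def)
  also have "\<dots> = {0<..1} \<times> {0<..}"
    by (auto simp: found_pairs_column_strategy_zero image_iff)
  finally have eq: "found_pairs column_strategy (1, 0) = {0<..1} \<times> {0<..}" .
  show sets: "found_pairs column_strategy (0, 1) \<in> sets borel" "found_pairs column_strategy (1, 0) \<in> sets borel"
    by (simp_all add: eq found_pairs_column_strategy_zero borel_Times)
  have area: "emeasure lborel ({0<..a} \<times> {0<..b}) = ennreal (a * b)" if "0 \<le> a" "0 \<le> b" for a b :: real
    using that by (simp add: lborel_prod[symmetric] lborel.emeasure_pair_measure_Times ennreal_mult)
  have "ennreal 3 = emeasure lborel ({0<..3::real} \<times> {0<..1::real})"
    using area[of 3 1] by simp
  also have "\<dots> \<le> score column_strategy (0, 1)"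
    using sets(1) unfolding score_def
    by (subst emeasure_completion) (auto simp: found_pairs_column_strategy_zero intro!: emeasure_mono)
  finally show "3 \<le> score column_strategy (0, 1)" by simp
  have "ennreal 3 = emeasure lborel ({0<..1::real} \<times> {0<..3::real})"
    using area[of 1 3] by simp
  also have "\<dots> \<le> score column_strategy (1, 0)"
    using sets(2) unfolding score_def
    by (subst emeasure_completion) (auto simp: eq intro!: emeasure_mono)
  finally show "3 \<le> score column_strategy (1, 0)" by simp
qed

section \<open>A lower bound for the area of the found region\<close>

definition found_first :: "real \<times> real \<Rightarrow> (real \<times> real) set" where
  "found_first y = {x. 0 < fst x \<and> fst x < snd x \<and> start (fst x) \<le> 1 \<and> fst y \<le> col_depth (fst x) \<and>
     snd x \<le> fst x + (1 - start (fst x)) / snd y}"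

lemma sets_found_first: "found_first y \<in> sets (lborel \<Otimes>\<^sub>M lborel)"
proof -
  have "{x \<in> space (lborel \<Otimes>\<^sub>M lborel). x \<in> found_first y} \<in> sets (lborel \<Otimes>\<^sub>M lborel)"
    unfolding found_first_def mem_Collect_eq by measurable
  then show ?thesis by (simp add: space_pair_measure)
qed

text \<open>The slice at \<open>x\<close> has length \<open>(1 - start x) / y2\<close>. The integral
  of \<open>1 - start x\<close> is \<open>3/8\<close> over the deep columns and \<open>1/6\<close>
  over the shallow ones, which can reveal the first nut only if \<open>y1 \<le> 3/4\<close>.\<close>

lemma emeasure_found_first_ge:
  assumes y: "y1 \<le> 1" "0 < y2"
  shows "ennreal ((3/8 + (if y1 \<le> 3/4 then 1/6 else 0)) / y2) \<le> emeasure lborel (found_first (y1, y2))"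
proof -
  define e :: real where "e = (if y1 \<le> 3/4 then 1 else 0)"
  \<comment> \<open>For \<open>x \<ge> 1/2\<close> one has
    \<open>1 - start x = (7 - 6 * x) / 8\<close>.\<close>
  define K where "K = e / (8 * y2)"
  have K: "0 \<le> K" using y by (simp add: K_def e_def)
  let ?g1 = "\<lambda>x::real. (1 - x) / y2" and ?g2 = "\<lambda>x::real. K * (7 - 6 * x)"
  have 1: "(\<integral>\<^sup>+x. ennreal (?g1 x) * indicator {0..1/2} x \<partial>lborel) = ennreal (3/8 / y2)"
  proof -
    have "(\<integral>\<^sup>+x. ennreal (?g1 x) * indicator {0..1/2} x \<partial>lborel)
        = (1/2 - (1/2)\<^sup>2 / 2) / y2 - (0 - 0\<^sup>2 / 2) / y2"
      using y by (intro nn_integral_FTC_Icc) (auto intro!: derivative_eq_intros)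
    then show ?thesis by (simp add: power2_eq_square)
  qed
  have 2: "(\<integral>\<^sup>+x. ennreal (?g2 x) * indicator {1/2..7/6} x \<partial>lborel) = ennreal (e / 6 / y2)"
  proof -
    have "(\<integral>\<^sup>+x. ennreal (?g2 x) * indicator {1/2..7/6} x \<partial>lborel)
        = K * (7 * (7/6) - 3 * (7/6)\<^sup>2) - K * (7 * (1/2) - 3 * (1/2)\<^sup>2)"
      by (intro nn_integral_FTC_Icc) (auto intro!: derivative_eq_intros mult_nonneg_nonneg K)
    also have "\<dots> = e / 6 / y2"
      by (simp add: K_def power2_eq_square field_simps)
    finally show ?thesis .
  qed
  \<comment> \<open>At \<open>0\<close> the slice is empty, and at \<open>1/2\<close> both
    indicators count; these two points form a null set.\<close>
  have slice: "ennreal (?g1 x) * indicator {0..1/2} x + ennreal (?g2 x) * indicator {1/2..7/6} x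
      \<le> emeasure lborel (Pair x -` found_first (y1, y2))" if x: "x \<noteq> 0" "x \<noteq> 1/2" for x
  proof -
    have full: "Pair x -` found_first (y1, y2) = {x<..x + (1 - start x) / y2}"
      if "0 < x" "start x \<le> 1" "y1 \<le> col_depth x"
      using that by (auto simp: found_first_def)
    consider "x < 0" | "0 < x \<and> x < 1/2" | "1/2 < x \<and> x \<le> 7/6" | "7/6 < x"
      using x by linarith
    then show ?thesis
    proof cases
      case 2
      then have st: "start x = x" and "col_depth x = 1"
        by (auto simp: start_def col_depth_def)
      then have "emeasure lborel (Pair x -` found_first (y1, y2)) = ennreal (?g1 x)"
        using 2 y by (subst full) auto
      then show ?thesis using 2 by auto
    next
      case 3
      then have st: "start x = (6 * x + 1) / 8" and "col_depth x = 3/4"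
        by (auto simp: start_def col_depth_def)
      then have "emeasure lborel (Pair x -` found_first (y1, y2)) = ennreal (?g2 x)" if "y1 \<le> 3/4"
        using 3 y that by (subst full) (auto simp: K_def e_def field_simps)
      then show ?thesis using 3 by (auto simp: K_def e_def)
    qed auto
  qed
  have "ennreal ((3/8 + (if y1 \<le> 3/4 then 1/6 else 0)) / y2) = ennreal (3/8 / y2) + ennreal (e / 6 / y2)"
    using y by (subst ennreal_plus[symmetric]) (auto simp: e_def field_simps)
  also have "\<dots> = (\<integral>\<^sup>+x. ennreal (?g1 x) * indicator {0..1/2} x + ennreal (?g2 x) * indicator {1/2..7/6} x \<partial>lborel)"
    unfolding 1[symmetric] 2[symmetric] by (subst nn_integral_add) auto
  also have "\<dots> \<le> (\<integral>\<^sup>+x. emeasure lborel (Pair x -` found_first (y1, y2)) \<partial>lborel)"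
  proof (rule nn_integral_mono_AE)
    have "AE x in lborel. x \<noteq> 0 \<and> x \<noteq> (1/2 :: real)"
      using AE_lborel_singleton[of "0 :: real"] AE_lborel_singleton[of "1/2 :: real"] by auto
    then show "AE x in lborel. ennreal (?g1 x) * indicator {0..1/2} x + ennreal (?g2 x) * indicator {1/2..7/6} x
      \<le> emeasure lborel (Pair x -` found_first (y1, y2))"
      using slice by auto
  qed
  also have "\<dots> = emeasure (lborel \<Otimes>\<^sub>M lborel) (found_first (y1, y2))"
    by (rule lborel.emeasure_pair_measure_alt[OF sets_found_first, symmetric])
  finally show ?thesis by (simp add: lborel_prod)
qed

text \<open>Both orders contribute. If both depths are at most \<open>3/4\<close>, the sum is
  \<open>13/24 / (y1 * y2)\<close>, at least \<open>13/6\<close>; otherwise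
  \<open>49/24 = 3/2 + 13/24\<close> is the bound.\<close>

lemma score_column_strategy_ge:
  assumes y: "0 < y1" "0 < y2" "y1 + y2 = 1"
  shows "ennreal (49/24) \<le> emeasure lborel (found_region (y1, y2))"
proof -
  define A where "A = found_first (y1, y2)"
  define B where "B = (\<lambda>(x, y). (y, x)) -` found_first (y2, y1) \<inter> space (lborel \<Otimes>\<^sub>M lborel)"
  have A: "A \<in> sets (lborel \<Otimes>\<^sub>M lborel)" unfolding A_def by (rule sets_found_first)
  have B: "B \<in> sets (lborel \<Otimes>\<^sub>M lborel)"
    unfolding B_def by (rule measurable_sets[OF measurable_pair_swap' sets_found_first])
  have B_eq: "emeasure (lborel \<Otimes>\<^sub>M lborel) B = emeasure (lborel \<Otimes>\<^sub>M lborel) (found_first (y2, y1))"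
    unfolding B_def
    by (subst (2) lborel_pair.distr_pair_swap)
      (rule emeasure_distr[OF measurable_pair_swap' sets_found_first, symmetric])
  define c where "c y = (3/8 + (if y \<le> 3/4 then 1/6 else 0) :: real)" for y :: real
  have c_nonneg: "0 \<le> c y" for y by (auto simp: c_def)
  have "49/24 \<le> c y1 / y2 + c y2 / y1"
  proof -
    have prod: "4 * (y1 * y2) \<le> 1"
    proof -
      have "0 \<le> (y1 - y2)\<^sup>2" by simp
      also have "\<dots> = (y1 + y2)\<^sup>2 - 4 * (y1 * y2)" by (simp add: power2_eq_square algebra_simps)
      finally show ?thesis using y(3) by simp
    qed
    \<comment> \<open>Here \<open>s\<close> is the smaller depth, below \<open>1/4\<close> when the
      other depth \<open>t\<close> exceeds \<open>3/4\<close>. The deeper nut, if first, is found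
      only in the columns of depth \<open>1\<close>, whence the weight \<open>3/8\<close>.\<close>
    have half: "49/24 \<le> a / s + b / t" if "3/8 \<le> a" "13/24 \<le> b" "0 < s" "s \<le> 1/4" "0 < t" "t \<le> 1" for a b s t :: real
    proof -
      have "3/2 \<le> a / s" using that by (simp add: field_simps)
      moreover have "13/24 \<le> b / t" using that by (simp add: field_simps)
      ultimately have "3/2 + 13/24 \<le> a / s + b / t" by (rule add_mono)
      then show ?thesis by linarith
    qed
    consider "y1 \<le> 3/4 \<and> y2 \<le> 3/4" | "3/4 < y1" | "3/4 < y2" by linarith
    then show ?thesis
    proof cases
      case 1
      then have "c y1 / y2 + c y2 / y1 = 13/24 / (y1 * y2)"
        using y by (simp add: c_def field_simps)
      also have "\<dots> \<ge> 13/24 / (1/4)"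
        using prod y by (intro divide_left_mono) auto
      finally show ?thesis by (rule order_trans[rotated]) simp
    next
      case 2
      then show ?thesis using half[of "c y1" "c y2" y2 y1] y by (auto simp: c_def)
    next
      case 3
      then show ?thesis using half[of "c y2" "c y1" y1 y2] y by (auto simp: c_def)
    qed
  qed
  then have "ennreal (49/24) \<le> ennreal (c y1 / y2) + ennreal (c y2 / y1)"
    using c_nonneg y by (simp add: ennreal_leI flip: ennreal_plus)
  also have "\<dots> \<le> emeasure lborel (found_first (y1, y2)) + emeasure lborel (found_first (y2, y1))"
    unfolding c_def using y by (intro add_mono emeasure_found_first_ge) auto
  also have "\<dots> = emeasure (lborel \<Otimes>\<^sub>M lborel) A + emeasure (lborel \<Otimes>\<^sub>M lborel) B"
    unfolding B_eq by (simp add: A_def lborel_prod)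
  \<comment> \<open>The strict inequality of locations in \<open>found_first\<close> makes the two
    orders disjoint.\<close>
  also have "\<dots> = emeasure (lborel \<Otimes>\<^sub>M lborel) (A \<union> B)"
    by (rule plus_emeasure[OF A B]) (auto simp: A_def B_def found_first_def)
  also have "\<dots> = emeasure lborel (A \<union> B)" by (simp add: lborel_prod)
  also have "\<dots> \<le> emeasure lborel (found_region (y1, y2))"
    using sets_found_region[of "(y1, y2)"]
    by (intro emeasure_mono) (auto simp: A_def B_def found_first_def found_region_def found_after_def)
  finally show ?thesis .
qed

section \<open>The column strategy against mixed strategies of the hider\<close>

lemma XDLG_cases:
  assumes "y \<in> XDLG"
  obtains "y = (0, 1)" | "y = (1, 0)"
    | y1 y2 where "y = (y1, y2)" "0 < y1" "0 < y2" "y1 + y2 = 1"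
  using assms unfolding XDLG_def by (cases y) fastforce

lemma column_strategy_XDLG:
  assumes "y \<in> XDLG"
  shows "found_pairs column_strategy y \<in> sets lebesgue" "ennreal (49/24) \<le> score column_strategy y"
proof -
  have "found_pairs column_strategy y \<in> sets lebesgue \<and> ennreal (49/24) \<le> score column_strategy y"
    using assms
  proof (cases rule: XDLG_cases)
    case 1
    have "ennreal (49/24) \<le> 3" by (simp flip: ennreal_numeral)
    then show ?thesis using 1 score_column_strategy_zero(1,2) by (auto intro: order_trans)
  next
    case 2
    have "ennreal (49/24) \<le> 3" by (simp flip: ennreal_numeral)
    then show ?thesis using 2 score_column_strategy_zero(3,4) by (auto intro: order_trans)
  next
    case (3 y1 y2)
    then show ?thesis
      using found_pairs_column_strategy[of y1 y2] score_column_strategy_ge[of y1 y2] sets_found_region[of y]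
      by (simp add: score_def)
  qed
  then show "found_pairs column_strategy y \<in> sets lebesgue" "ennreal (49/24) \<le> score column_strategy y"
    by auto
qed

text \<open>The area of \<open>found_region\<close> is the score except possibly at the two
  endpoints of \<open>XDLG\<close>, and changing a measurable function at two points keeps it
  measurable.\<close>

lemma measurable_score_column_strategy:
  "score column_strategy \<in> borel_measurable (restrict_space borel XDLG)"
proof (rule measurable_discrete_difference[where X = "{(0, 1), (1, 0)}"])
  show "(\<lambda>y. emeasure lborel (found_region y)) \<in> borel_measurable (restrict_space borel XDLG)"
    by (rule measurable_restrict_space1[OF measurable_emeasure_found_region])
  show "emeasure lborel (found_region y) = score column_strategy y"
    if "y \<in> space (restrict_space borel XDLG)" "y \<notin> {(0, 1), (1, 0)}" for y
  proof -
    have "y \<in> XDLG" using that by (simp add: space_restrict_space)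
    then show ?thesis
      using that(2) found_pairs_column_strategy sets_found_region[of y]
      by (cases rule: XDLG_cases) (auto simp: score_def)
  qed
  show "{y} \<in> sets (restrict_space borel XDLG)" if "y \<in> {(0, 1), (1, 0)}" for y
    using that by (auto simp: sets_restrict_space image_iff XDLG_def intro!: bexI[of _ "{y}"])
qed auto

text \<open>On a one-point space of strategies, measurability in the strategy is automatic.\<close>

definition column_mixed :: "strategy measure" where
  "column_mixed = return (count_space {column_strategy}) column_strategy"

lemma prob_space_column_mixed: "prob_space column_mixed"
  unfolding column_mixed_def by (rule prob_space_return) simp

lemma space_column_mixed: "space column_mixed = {column_strategy}"
  by (simp add: column_mixed_def)

lemma
  assumes N: "N \<in> hider_mixed XDLG"
  shows expected_score_defined_column: "expected_score_defined column_mixed N"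
    and expected_score_column_ge: "ennreal (49/24) \<le> expected_score column_mixed N"
proof -
  interpret C: prob_space column_mixed by (rule prob_space_column_mixed)
  interpret N: prob_space N using N by (simp add: hider_mixed_def)
  interpret CN: pair_prob_space column_mixed N ..
  have sets_N: "sets N = sets (restrict_space borel XDLG)" using N by (simp add: hider_mixed_def)
  have space_N: "space N = XDLG" using sets_eq_imp_space_eq[OF sets_N] by (simp add: space_restrict_space)
  have space: "fst z = column_strategy" "snd z \<in> XDLG" if "z \<in> space (column_mixed \<Otimes>\<^sub>M N)" for z
    using that by (auto simp: space_pair_measure space_column_mixed space_N)
  have "score column_strategy \<in> borel_measurable N"
    using measurable_score_column_strategy by (simp add: measurable_cong_sets[OF sets_N refl])
  then have "(\<lambda>z. score column_strategy (snd z)) \<in> borel_measurable (column_mixed \<Otimes>\<^sub>M N)"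
    by measurable
  then have "(\<lambda>z. score (fst z) (snd z)) \<in> borel_measurable (column_mixed \<Otimes>\<^sub>M N)"
    by (rule measurable_cong[THEN iffD1, rotated]) (simp add: space)
  then have "(\<lambda>(\<sigma>, y). score \<sigma> y) \<in> borel_measurable (completion (column_mixed \<Otimes>\<^sub>M N))"
    unfolding case_prod_beta' by (rule measurable_completion)
  moreover have "AE (\<sigma>, y) in column_mixed \<Otimes>\<^sub>M N. found_pairs \<sigma> y \<in> sets lebesgue"
    unfolding case_prod_beta' by (rule AE_I2) (simp add: space column_strategy_XDLG)
  ultimately show "expected_score_defined column_mixed N"
    by (simp add: expected_score_defined_def)
  have "ennreal (49/24) = (\<integral>\<^sup>+z. ennreal (49/24) \<partial>(column_mixed \<Otimes>\<^sub>M N))"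
    by (simp add: CN.emeasure_space_1)
  also have "\<dots> \<le> (\<integral>\<^sup>+z. score (fst z) (snd z) \<partial>(column_mixed \<Otimes>\<^sub>M N))"
    by (intro nn_integral_mono) (simp add: space column_strategy_XDLG)
  also have "\<dots> = expected_score column_mixed N"
    by (simp add: expected_score_def nn_integral_completion case_prod_beta')
  finally show "ennreal (49/24) \<le> expected_score column_mixed N" .
qed

lemma game_value_XDLG_ge:
  assumes "is_game_value XDLG v"
  shows "ennreal (49/24) \<le> v"
proof -
  have "column_mixed \<in> searcher_mixed XDLG"
    unfolding searcher_mixed_def
    using prob_space_column_mixed expected_score_defined_column column_strategy_pure
    by (auto simp: space_column_mixed)
  then have "(INF N\<in>hider_mixed XDLG. expected_score column_mixed N)
      \<le> (SUP M\<in>searcher_mixed XDLG. INF N\<in>hider_mixed XDLG. expected_score M N)"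
    by (rule SUP_upper)
  also have "\<dots> = v" using assms unfolding is_game_value_def by (elim conjE) (rule sym)
  finally show ?thesis
    using expected_score_column_ge by (meson INF_greatest order_trans)
qed

theorem theorem2p11:
  fixes v v\<^sub>X :: ennreal
  assumes "is_game_value DLG v"
    and "is_game_value XDLG v\<^sub>X"
  shows "v < v\<^sub>X"
proof -
  \<comment> \<open>For \<open>k \<ge> 2\<close>, \<open>2 * k / (k - 1) < 49/24\<close> means
    \<open>k > 49\<close>, so \<open>50\<close> is the smallest grid size that separates the
    values.\<close>
  have "v \<le> ennreal (100/49)"
    using game_value_DLG_le[OF assms(1), of 50] by simp
  also have "\<dots> < ennreal (49/24)"
    by (rule ennreal_lessI) simp_all
  also have "\<dots> \<le> v\<^sub>X"
    by (rule game_value_XDLG_ge[OF assms(2)])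
  finally show ?thesis .
qed

end
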